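(* Fix positive integers $n,m$. For each $d\geq 1$ let $W=W_d$ be a complex Wishart matrix of parameters $(dn,dm)$ and let $W^\Gamma=(\mathrm{id}\otimes\mathrm{t})W$ be its partial transpose. Then for every integer $p\geq 1$, $$\lim_{d\to\infty}(\mathbb E\circ \mathrm{tr})\big[(mW^\Gamma)^p\big]=\sum_{\pi\in NC(p)} m^{\#\pi}\,n^{\mathrm{e}(\pi)},$$ where $\#\pi$ is the number of blocks of $\pi$ and $\mathrm{e}(\pi)$ is the number of blocks of $\pi$ of even cardinality.
   Context: A complex Wishart matrix of parameters $(dn,dm)$ is $W=(dm)^{-1}GG^*$, where $G$ is a $dn\times dm$ matrix with i.i.d. standard complex Gaussian $\mathcal N(0,1)$ entries. Identify $M_{dn}(\mathbb C)=M_d(\mathbb C)\otimes M_n(\mathbb C)$ and index entries by pairs $(i,a)$ with $i\in\{1,\dots,d\}$, $a\in\{1,\dots,n\}$; the partial transpose is $W^\Gamma=(\mathrm{id}\otimes \mathrm{t})W$, i.e. $W^\Gamma_{ia,jb}=W_{ib,ja}$ ($\mathrm t$ is transposition on $M_n(\mathbb C)$). $\mathrm{tr}$ is the normalized trace $\mathrm{tr}(A)=(dn)^{-1}\sum_k A_{kk}$ on $M_{dn}(\mathbb C)$. $NC(p)$ is the set of noncrossing partitions of $\{1,\dots,p\}$. *)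

theory Defs
  imports "HOL-Probability.Probability" "HOL-Library.Disjoint_Sets" "Jordan_Normal_Form.Matrix"
begin

text \<open>Real and imaginary parts are independent real Gaussians of variance 1/2,
  so that E|z|^2 = 1.\<close>
definition complex_gaussian :: "complex measure" where
  "complex_gaussian =
     distr (density lborel (normal_density 0 (sqrt (1/2))) \<Otimes>\<^sub>M
            density lborel (normal_density 0 (sqrt (1/2))))
           borel (\<lambda>(x, y). Complex x y)"

definition gaussian_matrix_space :: "nat \<Rightarrow> nat \<Rightarrow> (nat \<times> nat \<Rightarrow> complex) measure" where
  "gaussian_matrix_space N M = PiM ({0..<N} \<times> {0..<M}) (\<lambda>_. complex_gaussian)"

definition gaussian_mat :: "nat \<Rightarrow> nat \<Rightarrow> (nat \<times> nat \<Rightarrow> complex) \<Rightarrow> complex mat" where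
  "gaussian_mat N M g = mat N M g"

definition conj_transpose :: "complex mat \<Rightarrow> complex mat" where
  "conj_transpose A = mat (dim_col A) (dim_row A) (\<lambda>(i, j). cnj (A $$ (j, i)))"

definition wishart :: "nat \<Rightarrow> nat \<Rightarrow> (nat \<times> nat \<Rightarrow> complex) \<Rightarrow> complex mat" where
  "wishart N M g = (1 / of_nat M) \<cdot>\<^sub>m (gaussian_mat N M g * conj_transpose (gaussian_mat N M g))"

text \<open>Partial transpose on M_d \<otimes> M_n (index (i,a) \<mapsto> i*n + a):
  W^\<Gamma>_{(i,a),(j,b)} = W_{(i,b),(j,a)}.\<close>
definition partial_transpose :: "nat \<Rightarrow> nat \<Rightarrow> complex mat \<Rightarrow> complex mat" where
  "partial_transpose d n W = mat (d * n) (d * n)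
     (\<lambda>(k, l). W $$ ((k div n) * n + l mod n, (l div n) * n + k mod n))"

definition ntrace :: "complex mat \<Rightarrow> complex" where
  "ntrace A = (\<Sum>k<dim_row A. A $$ (k, k)) / of_nat (dim_row A)"

definition noncrossing :: "nat set set \<Rightarrow> bool" where
  "noncrossing P \<longleftrightarrow> (\<forall>B1\<in>P. \<forall>B2\<in>P. \<forall>a b c e.
      a < b \<and> b < c \<and> c < e \<and> a \<in> B1 \<and> c \<in> B1 \<and> b \<in> B2 \<and> e \<in> B2 \<longrightarrow> B1 = B2)"

definition NC :: "nat \<Rightarrow> nat set set set" where
  "NC p = {P. partition_on {1..p} P \<and> noncrossing P}"

definition num_blocks :: "nat set set \<Rightarrow> nat" where
  "num_blocks P = card P"

definition num_even_blocks :: "nat set set \<Rightarrow> nat" where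
  "num_even_blocks P = card {B \<in> P. even (card B)}"

end

theory Submission
  imports Defs "HOL-Combinatorics.Orbits" "HOL-Computational_Algebra.Polynomial"
begin

text \<open>Expand the trace of the \<open>p\<close>-th power over index paths \<open>h\<close> around the cycle
  \<open>\<gamma> = (1 2 \<dots> p)\<close> and apply Wick's formula. A permutation \<open>f\<close> of \<open>{1..p}\<close> then
  matches the column indices along \<open>f\<close>, the \<open>M\<^sub>d\<close>-indices along \<open>\<gamma> f\<^sup>-\<^sup>1\<close> and, because of the
  partial transposition, the \<open>M\<^sub>n\<close>-indices along \<open>\<gamma> f\<close>. Its contribution is
  \<open>(dm)\<^sup>A d\<^sup>B n\<^sup>C / (n d\<^sup>p\<^sup>+\<^sup>1)\<close> with \<open>A\<close>, \<open>B\<close>, \<open>C\<close> the numbers of orbits of \<open>f\<close>, \<open>\<gamma> f\<^sup>-\<^sup>1\<close>, \<open>\<gamma> f\<close>.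
  One has \<open>A + B \<le> p + 1\<close>, with equality exactly if \<open>f\<close> rotates the blocks of a noncrossing
  partition \<open>\<pi>\<close> in increasing order, and then \<open>A = #\<pi>\<close> and \<open>C = 1 + e(\<pi>)\<close>. Both facts are proved by
  deleting points of \<open>{1..p}\<close> from the permutations.\<close>

subsection \<open>Orbits of a permutation and deletion of points\<close>

text \<open>Quotient and product with the cycle \<gamma> react differently to deletion. If
  \<open>f\<close> and \<gamma> both send \<open>t\<close> to \<open>s\<close>, the common step
  cancels in \<gamma> \<open>f\<close>^-1: this permutation fixes \<open>s\<close>, and deleting
  \<open>s\<close> merely drops that fixed point. So single deletions suffice for A + B. In \<gamma>
  \<open>f\<close> nothing cancels, and in general deletion of one point does not commute with this
  product. It does when \<open>s\<close> and \<open>t\<close> go together and either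
  \<open>f s = t\<close> or \<open>f\<close> and \<gamma> also share the predecessor of
  \<open>t\<close>. This is where parity enters: a block shrinks in steps of two, which cost no
  orbit of \<gamma> \<open>f\<close>, and only a block that ends with two points contributes an
  orbit of its own. For the bound on A + B the obstacle is a permutation without a deletable point.
  It is handled by counting fixed points: \<open>f\<close> has none and \<gamma> \<open>f\<close>^-1
  at most one, so both have mostly orbits of length at least two, which leaves A + B strictly below
  the bound.\<close>

text \<open>For injective \<open>f\<close> this is the first-return map to the complement of
  \<open>s\<close>. Composing with a transposition keeps it a total function that fixes
  \<open>s\<close>, so permutations of \<open>S\<close> and of \<open>S - {s}\<close> have the same
  type.\<close>

definition skip :: "'a \<Rightarrow> ('a \<Rightarrow> 'a) \<Rightarrow> 'a \<Rightarrow> 'a" where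
  "skip s f = Transposition.transpose s (f s) \<circ> f"

definition num_orbits :: "('a \<Rightarrow> 'a) \<Rightarrow> 'a set \<Rightarrow> nat" where
  "num_orbits f S = card (orbit f ` S)"

lemma skip_apply:
  assumes "inj f"
  shows "skip s f x = (if x = s then s else if f x = s then f s else f x)"
  using injD[OF assms, of x s] by (auto simp: skip_def Transposition.transpose_def)

lemma skip_fixed [simp]: "f s = s \<Longrightarrow> skip s f = f"
  by (simp add: skip_def)

lemma skip_permutes:
  assumes "f permutes S" "s \<in> S"
  shows "skip s f permutes (S - {s})"
proof -
  have "f s \<in> S"
    using assms by (simp add: permutes_in_image)
  then have "Transposition.transpose s (f s) \<circ> f permutes S"
    using assms by (intro permutes_compose permutes_swap_id)
  then have "skip s f permutes S"
    by (simp add: skip_def)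
  then show ?thesis
    by (rule permutes_superset) (simp add: skip_def)
qed

text \<open>Deletion forgets only the place of \<open>s\<close>, and a known predecessor
  \<open>t\<close> restores it.\<close>

lemma skip_cancel:
  assumes "skip s f = skip s g" "inj f" "inj g" "f t = s" "g t = s"
  shows "f = g"
proof -
  have "f s = g s"
    using fun_cong[OF assms(1), of t] assms(2-) by (auto simp: skip_apply split: if_splits)
  then have "Transposition.transpose s (f s) \<circ> f = Transposition.transpose s (f s) \<circ> g"
    using assms(1) by (simp add: skip_def)
  then show ?thesis
    by (metis comp_assoc transpose_comp_involutory id_comp)
qed

lemma permutes_orbit:
  assumes "f permutes S" "finite S"
  shows "x \<in> orbit f x" "y \<in> orbit f x \<Longrightarrow> orbit f y = orbit f x" "orbit f (f x) = orbit f x"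
proof -
  have p: "permutation f"
    using assms by (auto simp: permutation_permutes)
  show *: "x \<in> orbit f x" for x
    using p by (rule permutation_self_in_orbit)
  show **: "y \<in> orbit f x \<Longrightarrow> orbit f y = orbit f x" for y
    by (rule orbit_cyclic_eq3[OF cyclic_on_orbit[OF assms]])
  show "orbit f (f x) = orbit f x"
    by (rule **) (rule orbit.base)
qed

lemma orbit_invariant:
  assumes "y \<in> orbit f x" "f permutes S" "x \<in> S" "\<And>s. s \<in> S \<Longrightarrow> h (f s) = h s"
  shows "h y = h x"
proof -
  have "y \<in> S \<and> h y = h x"
    using assms(1) by induction (use assms in \<open>auto simp: permutes_in_image\<close>)
  then show ?thesis ..
qed

text \<open>An invariant function is a function on the set of orbits. This evaluates the index sums,
  with \<open>K\<close> an index range, and also compares orbit counts below, with \<open>K\<close>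
  of two elements.\<close>

lemma card_invariant_functions:
  assumes f: "f permutes S" and S: "finite S"
  shows "card {h \<in> S \<rightarrow>\<^sub>E K. \<forall>s\<in>S. h (f s) = h s} = card K ^ num_orbits f S"
proof -
  have "\<forall>B\<in>orbit f ` S. \<exists>s. s \<in> S \<and> orbit f s = B"
    by auto
  from bchoice[OF this] obtain r where r: "\<And>B. B \<in> orbit f ` S \<Longrightarrow> r B \<in> S \<and> orbit f (r B) = B"
    by blast
  have "bij_betw (\<lambda>h. \<lambda>s\<in>S. h (orbit f s)) (orbit f ` S \<rightarrow>\<^sub>E K) {h \<in> S \<rightarrow>\<^sub>E K. \<forall>s\<in>S. h (f s) = h s}"
  proof (rule bij_betwI[where g = "\<lambda>h. \<lambda>B\<in>orbit f ` S. h (r B)"], goal_cases)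
    case 1
    show ?case
      using f S by (auto simp: permutes_in_image permutes_orbit(3))
  next
    case 2
    show ?case
      using r by (simp add: PiE_iff)
  next
    case (3 h)
    then show ?case
      using r by (auto simp: PiE_iff extensional_def restrict_def fun_eq_iff)
  next
    case (4 h)
    have "h (r (orbit f s)) = h s" if s: "s \<in> S" for s
    proof -
      have "r (orbit f s) \<in> orbit f s"
        using r[of "orbit f s"] permutes_orbit(1)[OF f S, of "r (orbit f s)"] s by simp
      then show ?thesis
        using orbit_invariant[OF _ f s, of _ h] 4 by simp
    qed
    then show ?case
      using 4 by (auto simp: PiE_iff extensional_def restrict_def fun_eq_iff)
  qed
  from bij_betw_same_card[OF this] show ?thesis
    using S by (simp add: card_funcsetE num_orbits_def)
qed

text \<open>Counting invariant two-valued functions avoids following how orbits are cut: the value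
  at \<open>s\<close> is free if \<open>s\<close> is a fixed point and otherwise forced by the value
  at \<open>f s\<close>. The exponents of 2 are then compared.\<close>

lemma num_orbits_skip:
  assumes f: "f permutes S" and S: "finite S" and s: "s \<in> S"
  shows "num_orbits f S = num_orbits (skip s f) (S - {s}) + (if f s = s then 1 else 0)"
proof -
  define K where "K = {..<2::nat}"
  define I where "I f S = {h \<in> S \<rightarrow>\<^sub>E K. \<forall>s\<in>S. h (f s) = h s}" for f :: "'a \<Rightarrow> 'a" and S
  have K: "card K = 2"
    by (simp add: K_def)
  have inj: "inj f"
    using f by (rule permutes_inj)
  have sk: "skip s f permutes (S - {s})"
    using f s by (rule skip_permutes)
  have c: "card (I f S) = 2 ^ num_orbits f S"
    unfolding I_def using card_invariant_functions[OF f S, of K] by (simp add: K)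
  have c': "card (I (skip s f) (S - {s})) = 2 ^ num_orbits (skip s f) (S - {s})"
    unfolding I_def using card_invariant_functions[OF sk, of K] S by (simp add: K)
  have fS: "f x \<in> S \<longleftrightarrow> x \<in> S" for x
    using f by (simp add: permutes_in_image)
  have "card (I f S) = card (I (skip s f) (S - {s})) * (if f s = s then 2 else 1)"
  proof (cases "f s = s")
    case True
    have *: "f x = s \<longleftrightarrow> x = s" for x
      using True inj by (metis injD)
    have "bij_betw (\<lambda>(h, k). h(s := k)) (I f (S - {s}) \<times> K) (I f S)"
    proof (rule bij_betwI[where g = "\<lambda>h. (restrict h (S - {s}), h s)"], goal_cases)
      case 1 show ?case
        using s by (auto simp: I_def PiE_iff extensional_def True *)
    next
      case 2 show ?case
        using s by (auto simp: I_def PiE_iff fS * split: if_splits)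
    next
      case (3 x) then show ?case
        by (auto simp: I_def PiE_iff extensional_def fun_eq_iff)
    next
      case (4 y) then show ?case
        by (auto simp: I_def PiE_iff extensional_def fun_eq_iff)
    qed
    from bij_betw_same_card[OF this] show ?thesis
      using True by (simp add: card_cartesian_product K)
  next
    case False
    have "bij_betw (\<lambda>h. h(s := h (f s))) (I (skip s f) (S - {s})) (I f S)"
    proof (rule bij_betwI[where g = "\<lambda>h. restrict h (S - {s})"], goal_cases)
      case 1 show ?case
        using s False fS by (auto simp: I_def PiE_iff extensional_def skip_apply[OF inj])
    next
      case 2 show ?case
      proof (rule Pi_I)
        fix h assume h: "h \<in> I f S"
        have "h (f s) = h x" if "x \<in> S" "f x = s" for x
          using h that s by (auto simp: I_def)
        then show "restrict h (S - {s}) \<in> I (skip s f) (S - {s})"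
          using h False s by (auto simp: I_def skip_apply[OF inj] fS)
      qed
    next
      case (3 x) then show ?case
        using False by (auto simp: I_def PiE_iff extensional_def fun_eq_iff)
    next
      case (4 y) then show ?case
        using False s by (auto simp: I_def PiE_iff extensional_def fun_eq_iff fS)
    qed
    from bij_betw_same_card[OF this] show ?thesis
      using False by simp
  qed
  then have "(2::nat) ^ num_orbits f S =
      2 ^ (num_orbits (skip s f) (S - {s}) + (if f s = s then 1 else 0))"
    by (simp add: c c')
  then show ?thesis
    by (simp only: power_inject_exp)
qed

text \<open>Every orbit other than a fixed point uses up at least two points of
  \<open>S\<close>.\<close>

lemma num_orbits_le_fixed:
  assumes f: "f permutes S" and S: "finite S"
  shows "2 * num_orbits f S \<le> card S + card {s \<in> S. f s = s}"
proof -
  define O1 where "O1 = orbit f ` {s \<in> S. f s = s}"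
  define O2 where "O2 = orbit f ` S - O1"
  have sub: "B \<subseteq> S" if "B \<in> orbit f ` S" for B
    using that permutes_orbit_subset[OF f] by auto
  have fin: "finite (orbit f ` S)" "finite O1" "finite O2"
    using S by (auto simp: O1_def O2_def)
  have un: "orbit f ` S = O1 \<union> O2" "O1 \<inter> O2 = {}"
    by (auto simp: O1_def O2_def)
  have disj: "B \<inter> B' = {}" if "B \<in> orbit f ` S" "B' \<in> orbit f ` S" "B \<noteq> B'" for B B'
    using that permutes_orbit(2)[OF f S] by blast
  have "card O1 \<le> card {s \<in> S. f s = s}"
    unfolding O1_def using S by (intro card_image_le) auto
  moreover have "card O1 + 2 * card O2 \<le> card S"
  proof -
    have "card O1 + 2 * card O2 = (\<Sum>B\<in>O1. 1) + (\<Sum>B\<in>O2. 2)"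
      by simp
    also have "\<dots> \<le> (\<Sum>B\<in>O1. card B) + (\<Sum>B\<in>O2. card B)"
    proof (intro add_mono sum_mono)
      fix B assume "B \<in> O1"
      then show "1 \<le> card B"
        by (auto simp: O1_def orbit_eq_singleton_iff[THEN iffD2])
    next
      fix B assume B: "B \<in> O2"
      then obtain x where x: "x \<in> S" "B = orbit f x" "f x \<noteq> x"
        by (auto simp: O1_def O2_def)
      have "{x, f x} \<subseteq> B"
        using x permutes_orbit(1)[OF f S] by (auto intro: orbit.base)
      moreover have "finite B"
        using B sub S by (auto simp: O2_def intro: finite_subset)
      ultimately have "card {x, f x} \<le> card B"
        by (intro card_mono)
      then show "2 \<le> card B"
        using x by (simp add: card_insert_if split: if_splits)
    qed
    also have "\<dots> = (\<Sum>B\<in>orbit f ` S. card B)"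
      unfolding un(1) using fin un(2) by (simp add: sum.union_disjoint)
    also have "\<dots> = card (\<Union>(orbit f ` S))"
      using disj finite_subset[OF sub S]
      by (intro card_Union_disjoint[symmetric]) (auto simp: pairwise_def disjnt_def)
    also have "\<dots> \<le> card S"
      using sub S by (intro card_mono) auto
    finally show ?thesis .
  qed
  moreover have "num_orbits f S = card O1 + card O2"
    unfolding num_orbits_def un(1) using fin un(2) by (simp add: card_Un_disjoint)
  ultimately show ?thesis by linarith
qed

subsection \<open>Cyclic successor and block rotations\<close>

definition cyc_succ :: "'a::linorder set \<Rightarrow> 'a \<Rightarrow> 'a" where
  "cyc_succ B x = (if x \<in> B then if x = Max B then Min B else Min {y\<in>B. x < y} else x)"

lemma cyc_succ_outside: "x \<notin> B \<Longrightarrow> cyc_succ B x = x"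
  by (simp add: cyc_succ_def)

lemma cyc_succ_Max: "finite B \<Longrightarrow> B \<noteq> {} \<Longrightarrow> cyc_succ B (Max B) = Min B"
  by (simp add: cyc_succ_def)

lemma cyc_succ_greater:
  assumes "finite B" "x \<in> B" "x \<noteq> Max B"
  shows "cyc_succ B x \<in> B" "x < cyc_succ B x" "\<And>y. y \<in> B \<Longrightarrow> x < y \<Longrightarrow> cyc_succ B x \<le> y"
proof -
  have "x < Max B"
    using assms by (simp add: order_less_le)
  then have ne: "{y\<in>B. x < y} \<noteq> {}"
    using assms Max_in[of B] by blast
  have eq: "cyc_succ B x = Min {y\<in>B. x < y}"
    using assms by (simp add: cyc_succ_def)
  show "cyc_succ B x \<in> B" "x < cyc_succ B x"
    using Min_in[OF _ ne] assms by (auto simp: eq)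
  show "cyc_succ B x \<le> y" if "y \<in> B" "x < y" for y
    unfolding eq using that assms by (intro Min_le) auto
qed

lemma cyc_succ_in:
  assumes "finite B" "x \<in> B"
  shows "cyc_succ B x \<in> B"
proof (cases "x = Max B")
  case True
  then have "cyc_succ B x = Min B"
    using assms by (simp add: cyc_succ_def)
  then show ?thesis
    using Min_in[OF assms(1)] assms(2) by fastforce
qed (use assms cyc_succ_greater in blast)

lemma cyc_succ_eqI:
  assumes "finite B" "x \<in> B" "y \<in> B" "x < y" "\<And>z. z \<in> B \<Longrightarrow> x < z \<Longrightarrow> y \<le> z"
  shows "cyc_succ B x = y"
proof -
  have "x \<noteq> Max B"
    using Max_ge[OF assms(1,3)] assms(4) by (auto dest: leD)
  then show ?thesis
    using assms cyc_succ_greater[of B x] by (meson order_antisym)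
qed

lemma cyc_succ_eq_MinI:
  assumes "finite B" "x \<in> B" "y \<in> B" "\<And>z. z \<in> B \<Longrightarrow> z \<le> x" "\<And>z. z \<in> B \<Longrightarrow> y \<le> z"
  shows "cyc_succ B x = y"
proof -
  have "Max B = x" "Min B = y"
    using assms by (auto intro: Max_eqI Min_eqI)
  then show ?thesis
    using assms by (simp add: cyc_succ_def)
qed

lemma cyc_succ_eq_cases:
  assumes "finite B" "x \<in> B"
  obtains "x < cyc_succ B x" "\<And>z. z \<in> B \<Longrightarrow> x < z \<Longrightarrow> cyc_succ B x \<le> z"
    | "\<And>z. z \<in> B \<Longrightarrow> z \<le> x" "\<And>z. z \<in> B \<Longrightarrow> cyc_succ B x \<le> z"
proof (cases "x = Max B")
  case True
  then have "cyc_succ B x = Min B"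
    using assms by (simp add: cyc_succ_def)
  then show ?thesis
    using that(2) assms True by simp
next
  case False
  then show ?thesis
    using that(1) cyc_succ_greater[OF assms] by blast
qed

lemma cyc_succ_permutes:
  assumes "finite B"
  shows "cyc_succ B permutes B"
proof (rule bij_imp_permutes)
  have inj: "inj_on (cyc_succ B) B"
  proof (rule linorder_inj_onI')
    fix x y assume xy: "x \<in> B" "y \<in> B" "x < y"
    from assms xy(1) show "cyc_succ B x \<noteq> cyc_succ B y"
    proof (cases rule: cyc_succ_eq_cases)
      case 1
      from assms xy(2) show ?thesis
        by (cases rule: cyc_succ_eq_cases) (use 1 xy in force)+
    qed (use xy in force)
  qed
  moreover have "cyc_succ B ` B = B"
    using assms inj cyc_succ_in by (intro endo_inj_surj) auto
  ultimately show "bij_betw (cyc_succ B) B B"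
    by (simp add: bij_betw_def)
qed (rule cyc_succ_outside)

text \<open>Only the predecessor of \<open>s\<close> gets a new successor, namely that of
  \<open>s\<close>. Hence the big cycle and the block rotations keep their shape under
  deletion.\<close>

lemma cyc_succ_remove:
  assumes "finite B" "s \<in> B"
  shows "cyc_succ (B - {s}) = skip s (cyc_succ B)"
proof
  fix x
  have inj: "inj (cyc_succ B)"
    using cyc_succ_permutes[OF assms(1)] by (rule permutes_inj)
  consider "x \<notin> B - {s}" | "x \<in> B - {s}" "cyc_succ B x = s" | "x \<in> B - {s}" "cyc_succ B x \<noteq> s"
    by blast
  then show "cyc_succ (B - {s}) x = skip s (cyc_succ B) x"
  proof cases
    case 1
    then have "x = s \<or> x \<noteq> s \<and> cyc_succ B x = x"
      by (auto simp: cyc_succ_outside)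
    with 1 show ?thesis
      by (auto simp: skip_apply[OF inj] cyc_succ_outside)
  next
    case 2
    have ns: "cyc_succ B s \<in> B - {s}"
      using 2 injD[OF inj, of x s] assms cyc_succ_in[of B s] by auto
    \<comment> \<open>The two case splits record whether \<open>s\<close> and \<open>x\<close> are
      the maximum of \<open>B\<close>; both at once is impossible because \<open>x\<close> differs
      from \<open>s\<close>.\<close>
    have "cyc_succ (B - {s}) x = cyc_succ B s"
    proof -
      from assms(1) \<open>s \<in> B\<close> show ?thesis
      proof (cases rule: cyc_succ_eq_cases)
        case s: 1
        have "x \<in> B" using 2 by simp
        with assms(1) show ?thesis
        proof (cases rule: cyc_succ_eq_cases)
          case 1
          then show ?thesis
            using 2 assms s ns by (intro cyc_succ_eqI) force+
        next
          case 2
          then show ?thesis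
            using \<open>x \<in> B - {s}\<close> \<open>cyc_succ B x = s\<close> assms s ns
            by (intro cyc_succ_eq_MinI) (force simp: order_less_le)+
        qed
      next
        case s: 2
        have "x \<in> B" using 2 by simp
        with assms(1) show ?thesis
        proof (cases rule: cyc_succ_eq_cases)
          case 1
          then show ?thesis
            using 2 assms s ns by (intro cyc_succ_eq_MinI) force+
        next
          case 2
          then show ?thesis
            using \<open>x \<in> B - {s}\<close> \<open>cyc_succ B x = s\<close> assms s by force
        qed
      qed
    qed
    then show ?thesis
      using 2 by (simp add: skip_apply[OF inj])
  next
    case 3
    have "x \<in> B" using 3 by simp
    with assms(1) have "cyc_succ (B - {s}) x = cyc_succ B x"
    proof (cases rule: cyc_succ_eq_cases)
      case 1
      then show ?thesis
        using 3 assms cyc_succ_in[of B x] by (intro cyc_succ_eqI) auto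
    next
      case 2
      then show ?thesis
        using 3 assms cyc_succ_in[of B x] by (intro cyc_succ_eq_MinI) auto
    qed
    then show ?thesis
      using 3 by (auto simp: skip_apply[OF inj])
  qed
qed

text \<open>Transitivity of the cycle. The maximum of \<open>C\<close> cannot step upwards inside
  \<open>C\<close>, so it is \<open>Max B\<close>, and \<open>Min B\<close> lies in
  \<open>C\<close>. The first point of \<open>B\<close> missing from \<open>C\<close> would then be
  the successor of a point of \<open>C\<close>.\<close>

lemma cyc_succ_closed_subset:
  assumes B: "finite B" and C: "C \<subseteq> B" "C \<noteq> {}" "\<And>x. x \<in> C \<Longrightarrow> cyc_succ B x \<in> C"
  shows "C = B"
proof (rule ccontr)
  assume "C \<noteq> B"
  have fC: "finite C"
    using B C finite_subset by blast
  have "Max C \<in> C"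
    using C fC by (intro Max_in) auto
  have "cyc_succ B (Max C) \<le> Max C"
    using C fC \<open>Max C \<in> C\<close> by (intro Max_ge) auto
  then have "Max C = Max B"
    using cyc_succ_greater(2)[OF B, of "Max C"] \<open>Max C \<in> C\<close> C by force
  then have "Min B \<in> C"
    using C(3)[OF \<open>Max C \<in> C\<close>] B C(1,2) cyc_succ_Max[of B] by fastforce
  define y where "y = Min (B - C)"
  have y: "y \<in> B - C"
    unfolding y_def using B C \<open>C \<noteq> B\<close> by (intro Min_in) auto
  have ymin: "y \<le> z" if "z \<in> B - C" for z
    unfolding y_def using B that by (intro Min_le) auto
  define X where "X = {x\<in>B. x < y}"
  have "Min B \<in> X"
    using y \<open>Min B \<in> C\<close> C B by (auto simp: X_def order_less_le)
  then have "Max X \<in> X"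
    using B by (intro Max_in) (auto simp: X_def)
  then have "Max X \<in> C"
    using ymin by (force simp: X_def)
  moreover have "cyc_succ B (Max X) = y"
  proof (rule cyc_succ_eqI)
    show "y \<le> z" if "z \<in> B" "Max X < z" for z
    proof (rule ccontr)
      assume "\<not> y \<le> z"
      then have "z \<in> X"
        using that by (simp add: X_def)
      then have "z \<le> Max X"
        using B by (intro Max_ge) (auto simp: X_def)
      then show False
        using that by simp
    qed
  qed (use B y \<open>Max X \<in> X\<close> in \<open>auto simp: X_def\<close>)
  ultimately show False
    using C(3) y by auto
qed

section \<open>Rotation of all blocks of a set partition\<close>

definition block_perm :: "'a::linorder set set \<Rightarrow> 'a \<Rightarrow> 'a" where
  "block_perm P x = (if x \<in> \<Union>P then cyc_succ (THE B. B \<in> P \<and> x \<in> B) x else x)"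

lemma block_perm_outside: "x \<notin> \<Union>P \<Longrightarrow> block_perm P x = x"
  by (simp add: block_perm_def)

lemma block_perm_eq:
  assumes "disjoint P" "B \<in> P" "x \<in> B"
  shows "block_perm P x = cyc_succ B x"
proof -
  have "(THE B. B \<in> P \<and> x \<in> B) = B"
    using assms disjointD[OF assms(1)] by (intro the_equality) auto
  then show ?thesis
    using assms by (auto simp: block_perm_def)
qed

lemma partition_on_finite_block: "partition_on S P \<Longrightarrow> finite S \<Longrightarrow> B \<in> P \<Longrightarrow> finite B"
  by (auto simp: partition_on_def intro: finite_subset)

lemma partition_on_disjoint: "partition_on S P \<Longrightarrow> disjoint P"
  by (simp add: partition_on_def)

lemma block_perm_permutes:
  assumes P: "partition_on S P" and S: "finite S"
  shows "block_perm P permutes S"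
proof (rule bij_imp_permutes)
  note dis = partition_on_disjoint[OF P]
  have un: "\<Union>P = S"
    using P by (simp add: partition_on_def)
  note fin = partition_on_finite_block[OF P S]
  have inj: "inj_on (block_perm P) S"
  proof (rule inj_onI)
    fix x y assume xy: "x \<in> S" "y \<in> S" "block_perm P x = block_perm P y"
    obtain B C where BC: "B \<in> P" "x \<in> B" "C \<in> P" "y \<in> C"
      using xy un by blast
    then have eq: "cyc_succ B x = cyc_succ C y"
      using xy by (simp add: block_perm_eq[OF dis])
    then have "B = C"
      using cyc_succ_in[OF fin, of B x] cyc_succ_in[OF fin, of C y] BC disjointD[OF dis, of B C]
          by auto
    then show "x = y"
      using eq permutes_inj[OF cyc_succ_permutes[OF fin]] BC by (auto dest: injD)
  qed
  moreover have "block_perm P ` S \<subseteq> S"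
  proof
    fix y assume "y \<in> block_perm P ` S"
    then obtain x B where "y = block_perm P x" "x \<in> B" "B \<in> P"
      using un by blast
    then show "y \<in> S"
      using cyc_succ_in[OF fin, of B x] un by (auto simp: block_perm_eq[OF dis])
  qed
  ultimately show "bij_betw (block_perm P) S S"
    using endo_inj_surj[OF S] by (simp add: bij_betw_def)
  show "block_perm P x = x" if "x \<notin> S" for x
    using that un by (simp add: block_perm_outside)
qed

text \<open>If blocks \<open>B\<close> and \<open>C\<close> of the two partitions meet, their
  intersection is closed under the common rotation, so by transitivity it is all of
  \<open>B\<close>, and by symmetry all of \<open>C\<close>.\<close>

lemma block_perm_inject:
  assumes P: "partition_on S P" and Q: "partition_on S Q" and S: "finite S"
    and eq: "block_perm P = block_perm Q"
  shows "P = Q"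
proof -
  have *: "B \<subseteq> C" if P: "partition_on S P" and Q: "partition_on S Q"
    and eq: "block_perm P = block_perm Q" and BC: "B \<in> P" "C \<in> Q" "x \<in> B" "x \<in> C" for P Q B C x
  proof -
    have "B \<inter> C = B"
    proof (rule cyc_succ_closed_subset)
      show "cyc_succ B y \<in> B \<inter> C" if "y \<in> B \<inter> C" for y
        using that BC block_perm_eq[OF partition_on_disjoint[OF P], of B y]
          block_perm_eq[OF partition_on_disjoint[OF Q], of C y] eq
          cyc_succ_in[OF partition_on_finite_block[OF P S], of B y]
          cyc_succ_in[OF partition_on_finite_block[OF Q S], of C y] by auto
    qed (use BC partition_on_finite_block[OF P S] in auto)
    then show ?thesis by blast
  qed
  have "B \<in> Q" if P: "partition_on S P" and Q: "partition_on S Q"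
    and eq: "block_perm P = block_perm Q" and B: "B \<in> P" for P Q B
  proof -
    obtain x where "x \<in> B"
      using B P by (metis partition_on_def ex_in_conv)
    moreover obtain C where "C \<in> Q" "x \<in> C"
      using \<open>x \<in> B\<close> B P Q by (metis UnionE UnionI partition_on_def)
    ultimately show ?thesis
      using *[OF P Q eq, of B C x] *[OF Q P eq[symmetric], of C B x] B by auto
  qed
  from this[OF P Q eq] this[OF Q P eq[symmetric]] show ?thesis by blast
qed

text \<open>Stated for disjoint families rather than partitions because \<open>B - {s}\<close> is
  empty when \<open>B = {s}\<close>.\<close>

lemma block_perm_remove:
  assumes dis: "disjoint (insert B Q)" and B: "B \<notin> Q" "finite B" "s \<in> B"
    and inj: "inj (block_perm (insert B Q))"
  shows "block_perm (insert (B - {s}) Q) = skip s (block_perm (insert B Q))"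
proof
  fix x
  have BQ: "B \<inter> C = {}" if "C \<in> Q" for C
    using disjointD[OF dis, of B C] that B(1) by auto
  have QQ: "C \<inter> D = {}" if "C \<in> Q" "D \<in> Q" "C \<noteq> D" for C D
    using disjointD[OF dis, of C D] that by auto
  have dis': "disjoint (insert (B - {s}) Q)"
  proof (rule disjointI)
    fix C D assume "C \<in> insert (B - {s}) Q" "D \<in> insert (B - {s}) Q" "C \<noteq> D"
    then show "C \<inter> D = {}"
      using BQ QQ by blast
  qed
  have injB: "inj (cyc_succ B)"
    using cyc_succ_permutes[OF B(2)] by (rule permutes_inj)
  note e = block_perm_eq[OF dis] and e' = block_perm_eq[OF dis']
  consider "x \<notin> \<Union>(insert B Q)" | "x = s" | "x \<in> B" "x \<noteq> s" | C where "C \<in> Q" "x \<in> C" "x \<noteq> s"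
    by blast
  then show "block_perm (insert (B - {s}) Q) x = skip s (block_perm (insert B Q)) x"
  proof cases
    case 1
    then show ?thesis
      using B by (auto simp: skip_apply[OF inj] block_perm_outside)
  next
    case 2
    have "s \<notin> \<Union>(insert (B - {s}) Q)"
      using BQ B by auto
    then show ?thesis
      using 2 by (simp add: skip_apply[OF inj] block_perm_outside)
  next
    case 3
    then show ?thesis
      using B e[of B x] e[of B s] e'[of "B - {s}" x]
      by (simp add: skip_apply[OF inj] cyc_succ_remove skip_apply[OF injB])
  next
    case 4
    have C: "B \<inter> C = {}"
      using 4 BQ by simp
    have "cyc_succ C x \<noteq> s"
    proof
      assume "cyc_succ C x = s"
      then have "block_perm (insert B Q) x = s"
        using 4 e[of C x] by simp
      moreover obtain t where "t \<in> B" "cyc_succ B t = s"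
        using cyc_succ_permutes[OF B(2)] B(3) by (metis permutes_def)
      ultimately have "x = t"
        using injD[OF inj, of x t] e[of B t] by simp
      then show False
        using C 4 \<open>t \<in> B\<close> by blast
    qed
    then show ?thesis
      using 4 e[of C x] e'[of C x] by (simp add: skip_apply[OF inj])
  qed
qed

subsection \<open>Noncrossing partitions as permutations of genus zero\<close>

lemma num_orbits_singleton [simp]: "num_orbits f {x} = 1"
  by (simp add: num_orbits_def)

section \<open>Effect of deletion on quotients and products with the big cycle\<close>

lemma skip_comp_inv_fixed:
  assumes "inj f" "f s = s"
  shows "skip s g \<circ> inv_into UNIV f = skip s (g \<circ> inv_into UNIV f)"
proof -
  have "inv_into UNIV f s = s"
    using assms by (metis inv_f_f)
  then show ?thesis
    by (simp add: skip_def comp_assoc)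
qed

text \<open>The quotient sends \<open>f x\<close> to \<open>g x\<close>. At \<open>x = t\<close>
  this says that it fixes \<open>s\<close>. Deleting \<open>s\<close> sends \<open>t\<close> to
  \<open>f s\<close> and \<open>g s\<close> instead, a pair that the quotient matches
  already.\<close>

lemma skip_comp_inv_skip:
  assumes f: "f permutes S" and g: "g permutes S" and s: "s \<in> S" and t: "f t = s" "g t = s"
  shows "skip s g \<circ> inv_into UNIV (skip s f) = g \<circ> inv_into UNIV f"
proof -
  have inj: "inj f" "inj g"
    using f g by (auto intro: permutes_inj)
  have "skip s g x = (g \<circ> inv_into UNIV f) (skip s f x)" for x
  proof -
    have w: "g (inv_into UNIV f (f y)) = g y" for y
      using inj by simp
    have "g (inv_into UNIV f s) = s"
      using w[of t] t by simp
    moreover have "f x = s \<longleftrightarrow> x = t" "g x = s \<longleftrightarrow> x = t"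
      using injD[OF inj(1), of x t] injD[OF inj(2), of x t] t by auto
    ultimately show ?thesis
      using w by (auto simp: skip_apply inj)
  qed
  then have "skip s g = (g \<circ> inv_into UNIV f) \<circ> skip s f"
    by auto
  moreover have "skip s f \<circ> inv_into UNIV (skip s f) = id"
    using permutes_inv_o(1)[OF skip_permutes[OF f s]] .
  ultimately show ?thesis
    by (simp add: comp_assoc)
qed

text \<open>With \<open>f r = t\<close> and \<open>g r = t\<close>, deleting \<open>s\<close> alone
  would send \<open>r\<close> to \<open>g s\<close> in the product of the reduced maps but to
  \<open>g (f s)\<close> in the reduced product: two-step paths get out of phase. Deleting
  \<open>t\<close> as well restores the phase. With \<open>f s = t\<close>, the points
  \<open>s\<close> and \<open>t\<close> form a cycle of \<open>f\<close> that drops out as a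
  whole.\<close>

lemma skip_skip_comp:
  assumes inj: "inj f" "inj g" and t: "f t = s" "g t = s" and ne: "s \<noteq> t"
    and r: "f s = t \<or> (\<exists>r. r \<noteq> s \<and> f r = t \<and> g r = t)"
  shows "skip t (skip s g) \<circ> skip t (skip s f) = skip t (skip s (g \<circ> f))"
proof
  fix x
  have inj': "inj (skip s f)" "inj (skip s g)" "inj (g \<circ> f)" "inj (skip s (g \<circ> f))"
    using inj by (auto simp: skip_def intro!: inj_compose)
  have f: "f x = f y \<longleftrightarrow> x = y" "g x = g y \<longleftrightarrow> x = y" for x y
    using inj by (auto dest: injD)
  have fs: "f x = s \<longleftrightarrow> x = t" "g x = s \<longleftrightarrow> x = t" for x
    using f[of x t] t by auto
  from r show "(skip t (skip s g) \<circ> skip t (skip s f)) x = skip t (skip s (g \<circ> f)) x"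
  proof (elim disjE exE conjE)
    assume "f s = t"
    then have "f x = t \<longleftrightarrow> x = s" for x
      using f[of x s] by auto
    then show ?thesis
      by (simp add: skip_apply inj inj' fs t ne ne[symmetric] \<open>f s = t\<close>)
  next
    fix r assume r: "r \<noteq> s" "f r = t" "g r = t"
    then have "f x = t \<longleftrightarrow> x = r" "g x = t \<longleftrightarrow> x = r" for x
      using f[of x r] by auto
    then show ?thesis
      by (simp add: skip_apply inj inj' fs t ne ne[symmetric] r r(1)[symmetric])
  qed
qed

lemma cyc_succ_neq:
  assumes "finite S" "s \<in> S" "S \<noteq> {s}"
  shows "cyc_succ S s \<noteq> s"
  using assms(1,2)
proof (cases rule: cyc_succ_eq_cases)
  case 2
  obtain x where x: "x \<in> S" "x \<noteq> s"
    using assms by blast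
  then show ?thesis
    using 2 by (metis antisym)
qed auto

text \<open>The deletion costs \<open>f\<close> the orbit of \<open>s\<close>. Both products act on
  \<open>s\<close> like the big cycle, so they move it as soon as \<open>S\<close> has another
  point, and they lose no orbit.\<close>

lemma num_orbits_remove_fixed:
  assumes S: "finite S" "s \<in> S" and f: "f permutes S" "f s = s"
  shows "f permutes (S - {s})"
    and "num_orbits f S = num_orbits f (S - {s}) + 1"
    and "S \<noteq> {s} \<Longrightarrow> num_orbits (cyc_succ S \<circ> inv_into UNIV f) S
        = num_orbits (cyc_succ (S - {s}) \<circ> inv_into UNIV f) (S - {s})"
    and "S \<noteq> {s} \<Longrightarrow> num_orbits (cyc_succ S \<circ> f) S = num_orbits (cyc_succ (S - {s}) \<circ> f) (S - {s})"
proof -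
  note [simp] = skip_fixed[of f, OF f(2)]
  note cyc_succ = cyc_succ_permutes[OF S(1)]
  show "f permutes (S - {s})" "num_orbits f S = num_orbits f (S - {s}) + 1"
    using skip_permutes[OF f(1) S(2)] num_orbits_skip[OF f(1) S] f(2) by auto
  assume ne: "S \<noteq> {s}"
  have "inv_into UNIV f s = s"
    using f permutes_inv_eq[OF f(1)] by simp
  then show "num_orbits (cyc_succ S \<circ> inv_into UNIV f) S
      = num_orbits (cyc_succ (S - {s}) \<circ> inv_into UNIV f) (S - {s})"
    using num_orbits_skip[OF permutes_compose[OF permutes_inv[OF f(1)] cyc_succ] S] cyc_succ_neq[OF
        S ne]
      skip_comp_inv_fixed[OF permutes_inj[OF f(1)] f(2), of "cyc_succ S"]
    by (simp add: cyc_succ_remove S)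
  show "num_orbits (cyc_succ S \<circ> f) S = num_orbits (cyc_succ (S - {s}) \<circ> f) (S - {s})"
    using num_orbits_skip[OF permutes_compose[OF f(1) cyc_succ] S] cyc_succ_neq[OF S ne] f(2)
    by (simp add: cyc_succ_remove S skip_def comp_assoc)
qed

text \<open>Now \<open>f\<close> moves \<open>s\<close> while the quotient fixes it, so the lost
  orbit belongs to the quotient. As for a fixed point of \<open>f\<close>, the sum of the two orbit
  counts drops by one together with \<open>card S\<close>.\<close>

lemma num_orbits_remove_adjacent:
  assumes S: "finite S" "s \<in> S" and f: "f permutes S" "f t = s" and t: "cyc_succ S t = s" "t \<noteq> s"
  shows "num_orbits f S = num_orbits (skip s f) (S - {s})"
    and "num_orbits (cyc_succ S \<circ> inv_into UNIV f) S = num_orbits (cyc_succ (S - {s}) \<circ> inv_into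
        UNIV (skip s f)) (S - {s}) + 1"
proof -
  have "f s \<noteq> s"
    using f t permutes_inj[OF f(1)] by (metis injD)
  then show "num_orbits f S = num_orbits (skip s f) (S - {s})"
    using num_orbits_skip[OF f(1) S] by simp
  have "inv_into UNIV f s = t"
    using f permutes_inv_eq[OF f(1)] by simp
  then have *: "(cyc_succ S \<circ> inv_into UNIV f) s = s"
    using t by simp
  have p: "cyc_succ S \<circ> inv_into UNIV f permutes S"
    using f cyc_succ_permutes[OF S(1)] by (intro permutes_compose permutes_inv)
  show "num_orbits (cyc_succ S \<circ> inv_into UNIV f) S = num_orbits (cyc_succ (S - {s}) \<circ> inv_into UNIV
      (skip s f)) (S - {s}) + 1"
    using num_orbits_skip[OF p S] skip_fixed[of "cyc_succ S \<circ> inv_into UNIV f", OF *] *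
      skip_comp_inv_skip[OF f(1) cyc_succ_permutes[OF S(1)] S(2) f(2) t(1)] S
    by (simp add: cyc_succ_remove)
qed

text \<open>The product fixes \<open>s\<close> but not \<open>t\<close>, since a third point keeps
  \<open>s\<close> from being followed by \<open>t\<close> in the big cycle. The one orbit lost is
  the contribution of a block of even size.\<close>

lemma num_orbits_comp_remove_two_cycle:
  assumes S: "finite S" "s \<in> S" and t: "cyc_succ S t = s" "t \<in> S" "t \<noteq> s"
    and f: "f permutes S" "f t = s" "f s = t" and ne: "S \<noteq> {s, t}"
  shows "num_orbits (cyc_succ S \<circ> f) S =
    num_orbits (cyc_succ (S - {s} - {t}) \<circ> skip t (skip s f)) (S - {s} - {t}) + 1"
proof -
  let ?u = "cyc_succ S \<circ> f"
  have u: "?u permutes S"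
    using f cyc_succ_permutes[OF S(1)] by (intro permutes_compose)
  have us: "?u s = s"
    using f t by simp
  then have us': "?u permutes S - {s}"
    using skip_permutes[OF u S(2)] skip_fixed[of ?u, OF us] by simp
  have "cyc_succ S s \<noteq> t"
  proof
    assume *: "cyc_succ S s = t"
    have "{s, t} = S"
      by (rule cyc_succ_closed_subset) (use S t * in auto)
    then show False
      using ne by simp
  qed
  then have "?u t \<noteq> t"
    using f by simp
  then have "num_orbits ?u S = num_orbits (skip t ?u) (S - {s} - {t}) + 1"
    using num_orbits_skip[OF u S] us skip_fixed[of ?u, OF us] num_orbits_skip[OF us', of t] S t
        by simp
  moreover have "cyc_succ (S - {s} - {t}) \<circ> skip t (skip s f) = skip t ?u"
    using skip_skip_comp[of f "cyc_succ S" t s] f t skip_fixed[of ?u, OF us] S permutes_inj[OF f(1)]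
      permutes_inj[OF cyc_succ_permutes[OF S(1)]]
    by (simp add: cyc_succ_remove)
  ultimately show ?thesis by simp
qed

text \<open>The points \<open>r\<close>, \<open>t\<close>, \<open>s\<close> follow each other in
  both permutations. Neither deletion meets a fixed point of the product, so only the parity of a
  block's size can matter.\<close>

lemma num_orbits_comp_remove_pair:
  assumes S: "finite S" "s \<in> S" "t \<in> S" and t: "cyc_succ S t = s" "t \<noteq> s"
    and r: "cyc_succ S r = t" "r \<noteq> s" "f r = t"
    and f: "f permutes S" "f t = s"
  shows "num_orbits (cyc_succ S \<circ> f) S =
    num_orbits (cyc_succ (S - {s} - {t}) \<circ> skip t (skip s f)) (S - {s} - {t})"
proof -
  let ?u = "cyc_succ S \<circ> f"
  have u: "?u permutes S"
    using f cyc_succ_permutes[OF S(1)] by (intro permutes_compose)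
  have inj: "inj f" "inj (cyc_succ S)" "inj ?u"
    using f(1) cyc_succ_permutes[OF S(1)] u by (auto intro: permutes_inj)
  have "f s \<noteq> t"
    using r inj by (metis injD)
  then have us: "?u s \<noteq> s"
    using t inj by (metis injD comp_apply)
  have "cyc_succ S s \<noteq> t" "cyc_succ S s \<noteq> s"
    using r t inj by (metis injD)+
  then have ut: "skip s ?u t \<noteq> t"
    using f t by (auto simp: skip_apply[OF inj(3)])
  have "num_orbits ?u S = num_orbits (skip t (skip s ?u)) (S - {s} - {t})"
    using num_orbits_skip[OF u S(1,2)] us
      num_orbits_skip[OF skip_permutes[OF u S(2)], of t] ut S t by simp
  moreover have "cyc_succ (S - {s} - {t}) \<circ> skip t (skip s f) = skip t (skip s ?u)"
    using skip_skip_comp[of f "cyc_succ S" t s] f t r S inj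
    by (auto simp: cyc_succ_remove)
  ultimately show ?thesis by simp
qed

section \<open>Noncrossing partitions under insertion and deletion of points\<close>

lemma noncrossingD:
  assumes "noncrossing P" "B1 \<in> P" "B2 \<in> P" "a \<in> B1" "c \<in> B1" "b \<in> B2" "e \<in> B2"
    "a < b" "b < c" "c < e"
  shows "B1 = B2"
  using assms unfolding noncrossing_def by blast

lemma noncrossing_insert_singleton:
  assumes "noncrossing P"
  shows "noncrossing (insert {s} P)"
  unfolding noncrossing_def
proof (intro ballI allI impI)
  fix B1 B2 a b c e
  assume B: "B1 \<in> insert {s} P" "B2 \<in> insert {s} P"
    and *: "a < b \<and> b < c \<and> c < e \<and> a \<in> B1 \<and> c \<in> B1 \<and> b \<in> B2 \<and> e \<in> B2"
  then have "B1 \<noteq> {s}" "B2 \<noteq> {s}"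
    by auto
  then show "B1 = B2"
    using assms B * unfolding noncrossing_def by blast
qed

lemma noncrossing_insert_subset:
  assumes P: "noncrossing (insert B Q)" and "B' \<subseteq> B" "B \<notin> Q"
  shows "noncrossing (insert B' Q)"
  unfolding noncrossing_def
proof (intro ballI allI impI)
  fix B1 B2 a b c e
  assume B: "B1 \<in> insert B' Q" "B2 \<in> insert B' Q"
    and *: "a < b \<and> b < c \<and> c < e \<and> a \<in> B1 \<and> c \<in> B1 \<and> b \<in> B2 \<and> e \<in> B2"
  have nc: "C1 = C2" if "C1 \<in> insert B Q" "C2 \<in> insert B Q" "B1 \<subseteq> C1" "B2 \<subseteq> C2" for C1 C2
    using noncrossingD[OF P, of C1 C2 a c b e] that * by auto
  consider "B1 \<in> Q" "B2 \<in> Q" | "B1 = B'" "B2 = B'" | "B1 = B'" "B2 \<in> Q" | "B1 \<in> Q" "B2 = B'"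
    using B by blast
  then show "B1 = B2"
    by cases (use nc[of B1 B2] nc[of B B2] nc[of B1 B] assms in auto)
qed

text \<open>Moving \<open>s\<close> onto \<open>t\<close> keeps the strict order between points of
  different blocks, because no point of \<open>S\<close> lies between the two and both belong to
  \<open>B\<close>. A crossing would therefore survive in the smaller partition.\<close>

lemma noncrossing_insert_adjacent:
  assumes P: "partition_on S (insert B Q)" "B \<notin> Q" and S: "finite S" and t: "s \<in> B" "t \<in> B" "t < s"
    and adj: "cyc_succ S t = s" and nc: "noncrossing (insert (B - {s}) Q)"
  shows "noncrossing (insert B Q)"
  unfolding noncrossing_def
proof (intro ballI allI impI, rule ccontr)
  fix B1 B2 a b c e
  assume B: "B1 \<in> insert B Q" "B2 \<in> insert B Q" "B1 \<noteq> B2"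
    and *: "a < b \<and> b < c \<and> c < e \<and> a \<in> B1 \<and> c \<in> B1 \<and> b \<in> B2 \<and> e \<in> B2"
  define f where "f x = (if x = s then t else x)" for x
  have dis: "C = D" if "C \<in> insert B Q" "D \<in> insert B Q" "x \<in> C" "x \<in> D" for C D x
    using partition_on_disjoint[OF P(1)] that by (meson disjointD disjoint_iff)
  have un: "C \<subseteq> S" if "C \<in> insert B Q" for C
    using P that by (auto simp: partition_on_def)
  have "t \<in> S"
    using un t by auto
  have less: "f x < f y" if "x < y" "x \<in> C" "y \<in> D" "C \<in> insert B Q" "D \<in> insert B Q" "C \<noteq> D"
      for x y C D
  proof -
    have "t \<noteq> Max S"
      using Max_ge[OF S, of s] un[of B] t by auto
    then have "\<not> (t < z \<and> z < s)" if "z \<in> S" for z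
      using cyc_succ_greater(3)[OF S \<open>t \<in> S\<close>, of z] adj that by auto
    then have "\<not> (t < x \<and> x < s)" "\<not> (t < y \<and> y < s)"
      using that un by blast+
    moreover have "\<not> (x = t \<and> y = s)"
      using dis that t by (metis insertI1)
    ultimately show ?thesis
      using that(1) t(3) unfolding f_def by (auto simp: order_less_le)
  qed
  define C where "C X = (if X = B then B - {s} else X)" for X
  have C: "C X \<in> insert (B - {s}) Q" if "X \<in> insert B Q" for X
    using that by (auto simp: C_def)
  have fC: "f x \<in> C X" if "x \<in> X" "X \<in> insert B Q" for x X
  proof (cases "X = B")
    case True
    then show ?thesis
      using that t by (simp add: C_def f_def)
  next
    case False
    then have "x \<noteq> s"
      using that t dis[of X B s] by auto
    then show ?thesis
      using that False by (simp add: C_def f_def)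
  qed
  have "C B1 = C B2"
    using * B fC less[of a b B1 B2] less[of b c B2 B1] less[of c e B1 B2]
    by (intro noncrossingD[OF nc C C, of B1 B2 "f a" "f c" "f b" "f e"]) auto
  then have "f a \<in> C B1" "f a \<in> C B2"
    using fC[of a B1] * B by auto
  then have "f a \<in> B1" "f a \<in> B2"
    by (auto simp: C_def split: if_splits)
  then show False
    using dis[of B1 B2 "f a"] B by simp
qed

text \<open>A block of least width \<open>Max B - Min B\<close> will do. A point of \<open>S\<close>
  in a gap of \<open>B\<close> belongs to a block that must not cross \<open>B\<close>; that block
  is nested strictly between the extremes of \<open>B\<close> and would be narrower.\<close>

lemma noncrossing_interval_block:
  assumes P: "partition_on S P" and nc: "noncrossing P" and S: "finite S" "S \<noteq> {}"
  obtains B where "B \<in> P" "\<And>x. x \<in> S \<Longrightarrow> Min B \<le> x \<Longrightarrow> x \<le> Max B \<Longrightarrow> x \<in> B"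
proof -
  have "P \<noteq> {}"
    using P S by (auto simp: partition_on_def)
  moreover have "finite P"
    using P S by (metis finite_elements)
  ultimately have "Min ((\<lambda>B. Max B - Min B) ` P) \<in> (\<lambda>B. Max B - Min B) ` P"
    by (intro Min_in) auto
  then obtain B where B: "B \<in> P" "Min ((\<lambda>B. Max B - Min B) ` P) = Max B - Min B"
    by blast
  have min: "Max B - Min B \<le> Max C - Min C" if "C \<in> P" for C
    unfolding B(2)[symmetric] using that \<open>finite P\<close> by (intro Min_le) auto
  note B = B(1)
  have fin: "finite C" "C \<noteq> {}" if "C \<in> P" for C
    using that P S partition_on_finite_block[OF P S(1)] by (auto simp: partition_on_def)
  have "x \<in> B" if x: "x \<in> S" "Min B \<le> x" "x \<le> Max B" for x
  proof (rule ccontr)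
    assume "x \<notin> B"
    obtain C where C: "C \<in> P" "x \<in> C"
      using P x by (auto simp: partition_on_def)
    have MB: "Min B \<in> B" "Max B \<in> B"
      using fin[OF B] by auto
    have x': "Min B < x" "x < Max B"
      using x MB \<open>x \<notin> B\<close> by (auto simp: order_less_le)
    have disj: "y \<notin> B" if "y \<in> C" for y
      using P B C that \<open>x \<notin> B\<close> by (metis disjointD disjoint_iff partition_on_disjoint)
    have "Min B < y \<and> y < Max B" if "y \<in> C" for y
    proof -
      have "\<not> y < Min B"
        using noncrossingD[OF nc C(1) B, of y x "Min B" "Max B"] C that MB x' \<open>x \<notin> B\<close> by auto
      moreover have "\<not> y > Max B"
        using noncrossingD[OF nc B C(1), of "Min B" "Max B" x y] C that MB x' \<open>x \<notin> B\<close> by auto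
      ultimately show ?thesis
        using disj[OF that] MB by (metis linorder_neqE_nat)
    qed
    then have "Min B < Min C" "Max C < Max B" "Min C \<le> Max C"
      using fin[OF C(1)] by auto
    then show False
      using min[OF C(1)] by linarith
  qed
  then show ?thesis
    using that B by blast
qed

lemma partition_on_remove_element:
  assumes "partition_on S (insert B Q)" "B \<notin> Q" "s \<in> B" "B \<noteq> {s}"
  shows "partition_on (S - {s}) (insert (B - {s}) Q)" "B - {s} \<notin> Q"
proof -
  have BQ: "B \<inter> C = {}" if "C \<in> Q" for C
    using disjointD[OF partition_on_disjoint[OF assms(1)], of B C] that assms(2) by auto
  have QQ: "C \<inter> D = {}" if "C \<in> Q" "D \<in> Q" "C \<noteq> D" for C D
    using disjointD[OF partition_on_disjoint[OF assms(1)], of C D] that by auto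
  show "partition_on (S - {s}) (insert (B - {s}) Q)"
  proof (rule partition_onI)
    show "\<Union> (insert (B - {s}) Q) = S - {s}"
      using assms(1,3) BQ by (auto simp: partition_on_def)
    show "{} \<notin> insert (B - {s}) Q"
      using assms by (auto simp: partition_on_def)
    show "disjnt C D" if "C \<in> insert (B - {s}) Q" "D \<in> insert (B - {s}) Q" "C \<noteq> D" for C D
      using that BQ QQ unfolding disjnt_def by blast
  qed
  show "B - {s} \<notin> Q"
    using BQ assms by blast
qed

lemma partition_on_remove_block:
  assumes "partition_on S (insert B Q)" "B \<notin> Q"
  shows "partition_on (S - B) Q"
proof -
  have BQ: "B \<inter> C = {}" if "C \<in> Q" for C
    using disjointD[OF partition_on_disjoint[OF assms(1)], of B C] that assms(2) by auto
  show ?thesis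
  proof (rule partition_onI)
    show "\<Union> Q = S - B"
      using assms(1) BQ by (auto simp: partition_on_def)
    show "{} \<notin> Q"
      using assms by (auto simp: partition_on_def)
    show "disjnt C D" if "C \<in> Q" "D \<in> Q" "C \<noteq> D" for C D
      using partition_on_disjoint[OF assms(1)] that by (auto simp: disjnt_def dest: disjointD)
  qed
qed

lemma block_perm_insert_empty: "block_perm (insert {} Q) = block_perm Q"
  by (auto simp: block_perm_def fun_eq_iff intro!: arg_cong2[where f = cyc_succ] arg_cong[where f
      = The])

lemma skip_block_perm:
  assumes "partition_on S (insert B Q)" "B \<notin> Q" "finite S" "s \<in> B"
  shows "block_perm (insert (B - {s}) Q) = skip s (block_perm (insert B Q))"
  using assms partition_on_finite_block[OF assms(1,3), of B]
  by (intro block_perm_remove partition_on_disjoint[OF assms(1)] permutes_inj[OF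
      block_perm_permutes[OF assms(1,3)]]) auto

lemma block_perm_insert_singleton:
  assumes "partition_on S (insert {s} Q)" "{s} \<notin> Q" "finite S"
  shows "block_perm (insert {s} Q) = block_perm Q" "block_perm (insert {s} Q) s = s"
proof -
  show *: "block_perm (insert {s} Q) s = s"
    using block_perm_eq[OF partition_on_disjoint[OF assms(1)], of "{s}" s] by (simp add: cyc_succ_def)
  show "block_perm (insert {s} Q) = block_perm Q"
    using skip_block_perm[OF assms, of s] skip_fixed[of "block_perm (insert {s} Q)", OF *]
    by (simp add: block_perm_insert_empty)
qed

lemma num_even_blocks_insert:
  assumes "finite Q" "B \<notin> Q"
  shows "num_even_blocks (insert B Q) = num_even_blocks Q + (if even (card B) then 1 else 0)"
proof -
  have "{C \<in> insert B Q. even (card C)} =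
      (if even (card B) then insert B {C \<in> Q. even (card C)} else {C \<in> Q. even (card C)})"
    by auto
  then show ?thesis
    using assms by (simp add: num_even_blocks_def)
qed

text \<open>Take a block that is an interval of \<open>S\<close>. As long as it has at least three points, its two top
  points are deleted together, so that the parity of its size is kept; once it has at most two
  points, the whole block is deleted.\<close>
lemma num_orbits_block_perm:
  assumes "finite S" "S \<noteq> {}" "partition_on S P" "noncrossing P"
  shows "num_orbits (block_perm P) S = card P \<and>
    card P + num_orbits (cyc_succ S \<circ> inv_into UNIV (block_perm P)) S = card S + 1 \<and>
    num_orbits (cyc_succ S \<circ> block_perm P) S = num_even_blocks P + 1"
  using assms
proof (induction "card S" arbitrary: S P rule: less_induct)
  case less
  note S = less.prems(1,2) and P = less.prems(3) and nc = less.prems(4)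
  obtain B where "B \<in> P" and int: "\<And>x. x \<in> S \<Longrightarrow> Min B \<le> x \<Longrightarrow> x \<le> Max B \<Longrightarrow> x \<in> B"
    using noncrossing_interval_block[OF P nc S] by blast
  define Q where "Q = P - {B}"
  have PQ: "P = insert B Q" "B \<notin> Q"
    using \<open>B \<in> P\<close> by (auto simp: Q_def)
  note part = P[unfolded PQ(1)]
  have finP: "finite P" "finite Q"
    using P S finite_elements by (auto simp: Q_def)
  have B: "finite B" "B \<noteq> {}" "B \<subseteq> S"
    using P S \<open>B \<in> P\<close> partition_on_finite_block[OF P S(1)] by (auto simp: partition_on_def)
  let ?f = "block_perm P"
  have f: "?f permutes S"
    using block_perm_permutes[OF P S(1)] .
  have fB: "?f x = cyc_succ B x" if "x \<in> B" for x
    using block_perm_eq[OF partition_on_disjoint[OF P] \<open>B \<in> P\<close> that] .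
  have ncQ: "noncrossing Q"
    using nc by (auto simp: noncrossing_def PQ)
  define s where "s = Max B"
  have s: "s \<in> B" "s \<in> S"
    using Max_in[OF B(1,2)] B(3) unfolding s_def by blast+
  show ?case
  proof (cases "B = {s}")
    case True
    \<comment> \<open>A singleton block is a fixed point: \<open>card P\<close> and
      \<open>card S\<close> drop by one each, and the number of even blocks is unchanged.\<close>
    have fs: "?f s = s" and fQ: "block_perm P = block_perm Q"
      using block_perm_insert_singleton[of S s Q] part PQ S True by auto
    note rem = num_orbits_remove_fixed[OF S(1) s(2) f fs]
    show ?thesis
    proof (cases "S = {s}")
      case True
      then have "Q = {}"
        using partition_on_remove_block[OF part PQ(2)] \<open>B = {s}\<close> by (auto simp: partition_on_def)
      then show ?thesis
        using True PQ \<open>B = {s}\<close> by (simp add: num_even_blocks_def)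
    next
      case False
      have "card (S - {s}) < card S"
        using s S by (intro psubset_card_mono) auto
      moreover have "S - {s} \<noteq> {}"
        using False s by auto
      moreover have "partition_on (S - {s}) Q"
        using partition_on_remove_block[OF part PQ(2)] \<open>B = {s}\<close> by simp
      ultimately have "num_orbits (block_perm Q) (S - {s}) = card Q \<and>
          card Q + num_orbits (cyc_succ (S - {s}) \<circ> inv_into UNIV (block_perm Q)) (S - {s})
              = card (S - {s}) + 1 \<and>
          num_orbits (cyc_succ (S - {s}) \<circ> block_perm Q) (S - {s}) = num_even_blocks Q + 1"
        using S ncQ by (intro less.hyps) auto
      moreover have "card P = card Q + 1" "num_even_blocks P = num_even_blocks Q"
        using PQ finP True by (simp_all add: num_even_blocks_insert)
      moreover have "card S = card (S - {s}) + 1"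
        using card_Suc_Diff1[OF S(1) s(2)] by simp
      ultimately show ?thesis
        using rem(2) rem(3,4)[OF False] fQ by simp
    qed
  next
    case False
    define B1 where "B1 = B - {s}"
    define t where "t = Max B1"
    have B1: "finite B1" "B1 \<noteq> {}"
      using B s False by (auto simp: B1_def)
    have t1: "t \<in> B1"
      using B1 by (simp add: t_def)
    have t: "t \<in> B" "t \<noteq> s" "t \<in> S"
      using t1 B by (auto simp: B1_def)
    have "t < s"
      using t B Max_ge[of B t] by (simp add: s_def order_less_le)
    have tmax: "x \<le> t" if "x \<in> B" "x < s" for x
      using that B1 by (auto simp: t_def B1_def)
    have Bint: "x \<in> B" if "x \<in> S" "y \<in> B" "y \<le> x" "x \<le> s" for x y
      using Min_le[OF B(1) that(2)] that(3,4) by (intro int[OF that(1)]) (auto simp: s_def)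
    \<comment> \<open>The interval property makes the two top points of \<open>B\<close> neighbours
      in \<open>S\<close> as well, so the rotation and the big cycle agree at
      \<open>t\<close>.\<close>
    have nt: "cyc_succ S t = s"
    proof (rule cyc_succ_eqI)
      show "s \<le> z" if "z \<in> S" "t < z" for z
        using Bint[of z t] tmax[of z] that t(1) by (cases "z < s") auto
    qed (use S t s \<open>t < s\<close> in auto)
    have ft: "?f t = s"
      unfolding fB[OF t(1)]
    proof (rule cyc_succ_eqI)
      show "s \<le> z" if "z \<in> B" "t < z" for z
        using tmax[of z] that by (cases "z < s") auto
    qed (use B t s \<open>t < s\<close> in auto)
    note rem = num_orbits_remove_adjacent[OF S(1) s(2) f ft nt t(2)]
    have part1: "partition_on (S - {s}) (insert B1 Q)" "B1 \<notin> Q"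
      unfolding B1_def using partition_on_remove_element[OF part PQ(2) s(1) False] .
    have f1: "block_perm (insert B1 Q) = skip s ?f"
      unfolding B1_def PQ using skip_block_perm[OF part PQ(2) S(1) s(1)] .
    have f1p: "skip s ?f permutes S - {s}"
      using skip_permutes[OF f s(2)] .
    have S1: "finite (S - {s})" "t \<in> S - {s}"
      using S t by auto
    have cS: "card S = card (S - {s}) + 1" "card (S - {s}) = card (S - {s} - {t}) + 1"
      using card_Suc_Diff1[OF S(1) s(2)] card_Suc_Diff1[OF S1] by simp_all
    have cB: "card B = card B1 + 1" "card B1 = card (B1 - {t}) + 1"
      using card_Suc_Diff1[OF B(1) s(1)] card_Suc_Diff1[OF B1(1) t1] by (simp_all add: B1_def)
    show ?thesis
    proof (cases "B1 = {t}")
      case True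
      \<comment> \<open>Deleting \<open>s\<close> turns \<open>t\<close> into a fixed point, so two
        single deletions settle the first two counts. The third count needs the deletion of the
        pair.\<close>
      have "B = {s, t}"
        using True s by (auto simp: B1_def)
      have fs1: "skip s ?f t = t" and fQ: "skip s ?f = block_perm Q"
        using block_perm_insert_singleton[of "S - {s}" t Q] part1 S1 f1 unfolding True by auto
      have fs: "?f s = t"
        using fs1 ft skip_apply[OF permutes_inj[OF f], of s t] t by simp
      note rem1 = num_orbits_remove_fixed[OF S1 f1p fs1]
      have part2: "partition_on (S - {s} - {t}) Q"
        using partition_on_remove_block[OF part1] unfolding True .
      have cP: "card P = card Q + 1" "num_even_blocks P = num_even_blocks Q + 1"
        using PQ finP \<open>B = {s, t}\<close> t by (simp_all add: num_even_blocks_insert card_insert_if)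
      show ?thesis
      proof (cases "S = {s, t}")
        case True
        then have "S - {s} = {t}" and "S - {s} - {t} = {}"
          using t by auto
        then have "Q = {}"
          using part2 by (auto simp: partition_on_def)
        \<comment> \<open>On two points the product is the identity; its two orbits are the one even
          block plus 1.\<close>
        have "num_orbits (cyc_succ S \<circ> ?f) S = 2"
        proof -
          have u: "cyc_succ S \<circ> ?f permutes S"
            using f cyc_succ_permutes[OF S(1)] by (intro permutes_compose)
          have "(cyc_succ S \<circ> ?f) s = s"
            using fs nt by simp
          then show ?thesis
            using num_orbits_skip[OF u S(1) s(2)] \<open>S - {s} = {t}\<close> by simp
        qed
        then show ?thesis
          using rem \<open>S - {s} = {t}\<close> cP cS \<open>Q = {}\<close> by (simp add: num_even_blocks_def)
      next
        case False
        have ne: "S - {s} \<noteq> {t}"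
          using False s by auto
        have "num_orbits (block_perm Q) (S - {s} - {t}) = card Q \<and>
          card Q + num_orbits (cyc_succ (S - {s} - {t}) \<circ> inv_into UNIV (block_perm Q)) (S - {s} -
              {t}) = card (S - {s} - {t}) + 1 \<and>
          num_orbits (cyc_succ (S - {s} - {t}) \<circ> block_perm Q) (S - {s} - {t})
              = num_even_blocks Q + 1"
        proof (rule less.hyps)
          show "S - {s} - {t} \<noteq> {}"
            using ne S1 by auto
        qed (use cS S part2 ncQ in auto)
        moreover have "num_orbits (cyc_succ S \<circ> ?f) S =
            num_orbits (cyc_succ (S - {s} - {t}) \<circ> block_perm Q) (S - {s} - {t}) + 1"
          using num_orbits_comp_remove_two_cycle[OF S(1) s(2) nt t(3,2) f ft fs False]
            skip_fixed[of "skip s ?f", OF fs1] fQ by simp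
        ultimately show ?thesis
          using rem rem1(2) rem1(3)[OF ne] cP cS fQ by simp
      qed
    next
      case False
      \<comment> \<open>With at least three points in the block, \<open>r\<close>, \<open>t\<close>,
        \<open>s\<close> are consecutive both in \<open>B\<close> and in \<open>S\<close>. Dropping
        \<open>t\<close> and \<open>s\<close> keeps the number of blocks and the parity of the
        block.\<close>
      define B2 where "B2 = B1 - {t}"
      define r where "r = Max B2"
      have B2: "finite B2" "B2 \<noteq> {}" "B2 \<subseteq> B"
        using B1 t1 False by (auto simp: B2_def B1_def)
      have r2: "r \<in> B2"
        using B2 by (simp add: r_def)
      have r: "r \<in> B" "r \<noteq> s" "r \<noteq> t" "r \<in> S"
        using r2 B by (auto simp: B2_def B1_def)
      have "r < t"
        using r r2 B1 Max_ge[of B1 r] by (auto simp: t_def B2_def order_less_le)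
      have rmax: "x \<le> r" if "x \<in> B" "x < t" for x
        using that B2 \<open>t < s\<close> by (auto simp: r_def B2_def B1_def)
      have nr: "cyc_succ S r = t"
      proof (rule cyc_succ_eqI)
        show "t \<le> z" if "z \<in> S" "r < z" for z
          using Bint[of z r] rmax[of z] that r(1) \<open>t < s\<close> by (cases "z < t") auto
      qed (use S t r \<open>r < t\<close> in auto)
      have fr: "?f r = t"
        unfolding fB[OF r(1)]
      proof (rule cyc_succ_eqI)
        show "t \<le> z" if "z \<in> B" "r < z" for z
          using rmax[of z] that by (cases "z < t") auto
      qed (use B t r \<open>r < t\<close> in auto)
      have nr1: "cyc_succ (S - {s}) r = t" and fr1: "skip s ?f r = t"
        using nr fr t r(2) by (simp_all add: cyc_succ_remove S s skip_apply permutes_inj[OF f]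
            permutes_inj[OF cyc_succ_permutes[OF S(1)]])
      note rem1 = num_orbits_remove_adjacent[OF S1 f1p fr1 nr1 r(3)]
      have part2: "partition_on (S - {s} - {t}) (insert B2 Q)" "B2 \<notin> Q"
        unfolding B2_def using partition_on_remove_element[OF part1 t1 False] .
      have f2: "block_perm (insert B2 Q) = skip t (skip s ?f)"
        unfolding B2_def f1[symmetric] using skip_block_perm[OF part1 S1(1) t1] .
      have cP: "card P = card (insert B2 Q)" "num_even_blocks P = num_even_blocks (insert B2 Q)"
        using PQ finP part2(2) cB by (simp_all add: num_even_blocks_insert B2_def)
      have "num_orbits (block_perm (insert B2 Q)) (S - {s} - {t}) = card (insert B2 Q) \<and>
          card (insert B2 Q) + num_orbits (cyc_succ (S - {s} - {t}) \<circ> inv_into UNIV (block_perm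
              (insert B2 Q))) (S - {s} - {t})
            = card (S - {s} - {t}) + 1 \<and>
          num_orbits (cyc_succ (S - {s} - {t}) \<circ> block_perm (insert B2 Q)) (S - {s} - {t})
            = num_even_blocks (insert B2 Q) + 1"
      proof (rule less.hyps)
        show "S - {s} - {t} \<noteq> {}"
          using r by auto
        show "noncrossing (insert B2 Q)"
          using noncrossing_insert_subset[OF _ B2(3) PQ(2)] nc PQ(1) by simp
      qed (use cS S part2 in auto)
      moreover have "num_orbits (cyc_succ S \<circ> ?f) S =
          num_orbits (cyc_succ (S - {s} - {t}) \<circ> block_perm (insert B2 Q)) (S - {s} - {t})"
        unfolding f2 by (rule num_orbits_comp_remove_pair[OF S(1) s(2) t(3) nt t(2) nr r(2) fr f ft])
      ultimately show ?thesis
        unfolding cP using rem rem1 f2 cS by simp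
    qed
  qed
qed

text \<open>A deletable point lowers the orbit sum and \<open>card S\<close> by one each, and it can
  be reinserted into the partition found for the smaller set. Without a deletable point there are
  too few fixed points for equality.\<close>

lemma num_orbits_genus:
  assumes "finite S" "S \<noteq> {}" "f permutes S"
  shows "num_orbits f S + num_orbits (cyc_succ S \<circ> inv_into UNIV f) S \<le> card S + 1 \<and>
    (num_orbits f S + num_orbits (cyc_succ S \<circ> inv_into UNIV f) S = card S + 1 \<longrightarrow>
      (\<exists>P. partition_on S P \<and> noncrossing P \<and> f = block_perm P))"
  using assms
proof (induction "card S" arbitrary: S f rule: less_induct)
  case less
  note S = less.prems(1,2) and f = less.prems(3)
  let ?w = "cyc_succ S \<circ> inv_into UNIV f"
  have w: "?w permutes S"
    using f cyc_succ_permutes[OF S(1)] by (intro permutes_compose permutes_inv)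
  \<comment> \<open>Agreement with the big cycle is exploited only at an upward step
    \<open>t < f t\<close>. At the wrap-around from \<open>Max S\<close> to \<open>Min S\<close> the
    new point would not sit right above \<open>t\<close>, as
    \<open>noncrossing_insert_adjacent\<close> requires.\<close>
  consider s where "S = {s}" | s where "s \<in> S" "S \<noteq> {s}" "f s = s"
    | t where "t \<in> S" "cyc_succ S t = f t" "t < f t"
    | "\<And>s. s \<in> S \<Longrightarrow> f s \<noteq> s" "\<And>t. t \<in> S \<Longrightarrow> cyc_succ S t = f t \<Longrightarrow> t = Max S"
    using S cyc_succ_greater(2)[OF S(1)] by metis
  then show ?case
  proof cases
    case (1 s)
    have "f = block_perm {{s}}"
    proof
      have d: "disjoint {{s}}" by simp
      show "f x = block_perm {{s}} x" for x
        using f 1 permutes_in_image[OF f, of s] permutes_not_in[OF f, of x]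
          block_perm_eq[OF d, of "{s}" s] block_perm_outside[of x "{{s}}"]
        by (cases "x = s") (auto simp: cyc_succ_def)
    qed
    moreover have "partition_on S {{s}}" "noncrossing {{s}}"
      using 1 by (auto simp: partition_on_def noncrossing_def)
    ultimately show ?thesis
      using 1 by auto
  next
    case (2 s)
    note rem = num_orbits_remove_fixed[OF S(1) 2(1) f 2(3)]
    have c: "card S = card (S - {s}) + 1"
      using card_Suc_Diff1[OF S(1) 2(1)] by simp
    have "num_orbits f (S - {s}) + num_orbits (cyc_succ (S - {s}) \<circ> inv_into UNIV f) (S - {s})
        \<le> card (S - {s}) + 1 \<and>
      (num_orbits f (S - {s}) + num_orbits (cyc_succ (S - {s}) \<circ> inv_into UNIV f) (S - {s})
          = card (S - {s}) + 1 \<longrightarrow>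
        (\<exists>P. partition_on (S - {s}) P \<and> noncrossing P \<and> f = block_perm P))"
      using 2 S rem(1) c by (intro less.hyps) auto
    moreover have "\<exists>P. partition_on S P \<and> noncrossing P \<and> f = block_perm P"
      if P: "partition_on (S - {s}) P" "noncrossing P" "f = block_perm P" for P
    proof (intro exI conjI)
      have un: "\<Union>P = S - {s}" "{} \<notin> P"
        using P by (auto simp: partition_on_def)
      then have s: "{s} \<notin> P" "\<And>C. C \<in> P \<Longrightarrow> s \<notin> C"
        by auto
      show part: "partition_on S (insert {s} P)"
      proof (rule partition_onI)
        show "disjnt C D" if "C \<in> insert {s} P" "D \<in> insert {s} P" "C \<noteq> D" for C D
          using that s disjointD[OF partition_on_disjoint[OF P(1)], of C D] by (auto simp: disjnt_def)
      qed (use un 2 in auto)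
      show "f = block_perm (insert {s} P)"
        using block_perm_insert_singleton(1)[OF part s(1) S(1)] P(3) by simp
      show "noncrossing (insert {s} P)"
        using P(2) by (rule noncrossing_insert_singleton)
    qed
    ultimately show ?thesis
      using rem(2) rem(3)[OF 2(2)] c by auto
  next
    case (3 t)
    define s where "s = f t"
    have s: "s \<in> S" "t \<noteq> s" "t \<in> S - {s}" "f t = s" "cyc_succ S t = s"
      using 3 permutes_in_image[OF f] by (auto simp: s_def)
    note rem = num_orbits_remove_adjacent[OF S(1) s(1) f s(4,5,2)]
    have c: "card S = card (S - {s}) + 1"
      using card_Suc_Diff1[OF S(1) s(1)] by simp
    have "num_orbits (skip s f) (S - {s}) + num_orbits (cyc_succ (S - {s}) \<circ> inv_into UNIV (skip s
        f)) (S - {s}) \<le> card (S - {s}) + 1 \<and>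
      (num_orbits (skip s f) (S - {s}) + num_orbits (cyc_succ (S - {s}) \<circ> inv_into UNIV (skip s f))
          (S - {s}) = card (S - {s}) + 1 \<longrightarrow>
        (\<exists>P. partition_on (S - {s}) P \<and> noncrossing P \<and> skip s f = block_perm P))"
      using s S skip_permutes[OF f s(1)] c by (intro less.hyps) auto
    moreover have "\<exists>P. partition_on S P \<and> noncrossing P \<and> f = block_perm P"
      if P: "partition_on (S - {s}) P" "noncrossing P" "skip s f = block_perm P" for P
    proof -
      \<comment> \<open>The point \<open>s\<close> returns to the block of its predecessor
        \<open>t\<close>.\<close>
      obtain B' where B': "B' \<in> P" "t \<in> B'"
        using P s by (auto simp: partition_on_def)
      define B where "B = insert s B'"
      define Q where "Q = P - {B'}"
      have un: "\<Union>P = S - {s}" "{} \<notin> P"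
        using P by (auto simp: partition_on_def)
      then have sC: "s \<notin> C" if "C \<in> P" for C
        using that by auto
      have B: "B \<notin> Q" "s \<in> B" "t \<in> B" "B - {s} = B'" "P = insert (B - {s}) Q"
        using B' sC by (auto simp: B_def Q_def)
      have part: "partition_on S (insert B Q)"
      proof (rule partition_onI)
        show "\<Union> (insert B Q) = S"
          using un(1) s(1) B' by (auto simp: B_def Q_def)
        show "disjnt C D" if CD: "C \<in> insert B Q" "D \<in> insert B Q" "C \<noteq> D" for C D
        proof -
          have *: "C \<inter> D = {}" if "C \<in> P" "D \<in> P" "C \<noteq> D" for C D
            using disjointD[OF partition_on_disjoint[OF P(1)]] that by auto
          have **: "B \<inter> D = {}" if "D \<in> Q" for D
            using *[of B' D] that B' sC[of D] by (auto simp: B_def Q_def)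
          show ?thesis
            using CD * ** by (auto simp: disjnt_def Q_def)
        qed
      qed (use un(2) in \<open>auto simp: B_def Q_def\<close>)
      moreover have "f = block_perm (insert B Q)"
      proof (rule skip_cancel)
        show "skip s f = skip s (block_perm (insert B Q))"
          using skip_block_perm[OF part B(1) S(1) B(2)] P(3) B by simp
        show "inj f" "inj (block_perm (insert B Q))"
          using f block_perm_permutes[OF part S(1)] by (auto intro: permutes_inj)
        show "f t = s" by fact
        have "cyc_succ B t = s"
        proof (rule cyc_succ_eqI)
          have BS: "B \<subseteq> S"
            using part by (auto simp: partition_on_def)
          then show "finite B"
            using S finite_subset by auto
          have "t \<noteq> Max S"
            using 3 Max_ge[OF S(1) s(1)] by (auto simp: s_def)
          then show "s \<le> z" if "z \<in> B" "t < z" for z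
            using cyc_succ_greater(3)[OF S(1) 3(1), of z] s(5) BS that by auto
        qed (use B 3 s_def in auto)
        then show "block_perm (insert B Q) t = s"
          using block_perm_eq[OF partition_on_disjoint[OF part], of B t] B by simp
      qed
      moreover have "noncrossing (insert B Q)"
        using noncrossing_insert_adjacent[OF part B(1) S(1) B(2,3) _ s(5)] P(2) B 3 s_def by simp
      ultimately show ?thesis
        by blast
    qed
    ultimately show ?thesis
      using rem c by auto
  next
    case 4
    \<comment> \<open>A fixed point of \<open>?w\<close> means that \<open>f\<close> and the big
      cycle agree one step earlier, and only the wrap-around is left for that. One fixed point is
      affordable: twice the orbit sum is at most \<open>2 * card S + 1\<close>, hence below
      \<open>2 * (card S + 1)\<close>.\<close>
    have "{s \<in> S. ?w s = s} \<subseteq> {Min S}"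
    proof
      fix s assume "s \<in> {s \<in> S. ?w s = s}"
      then have s: "s \<in> S" "cyc_succ S (inv_into UNIV f s) = s"
        by auto
      have "f (inv_into UNIV f s) = s" "inv_into UNIV f s \<in> S"
        using f s permutes_inverses(1)[OF f] permutes_in_image[OF permutes_inv[OF f]] by auto
      then have "inv_into UNIV f s = Max S"
        using 4(2)[of "inv_into UNIV f s"] s by simp
      then show "s \<in> {Min S}"
        using s S by (simp add: cyc_succ_Max)
    qed
    then have "card {s \<in> S. ?w s = s} \<le> 1"
      using card_mono[of "{Min S}"] by simp
    moreover have "card {s \<in> S. f s = s} = 0"
      using 4(1) by (auto simp: card_eq_0_iff)
    ultimately have "2 * num_orbits f S \<le> card S" "2 * num_orbits ?w S \<le> card S + 1"
      using num_orbits_le_fixed[OF f S(1)] num_orbits_le_fixed[OF w S(1)] by linarith+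
    then have "num_orbits f S + num_orbits ?w S < card S + 1"
      by linarith
    then show ?thesis
      by linarith
  qed
qed

subsection \<open>Gaussian moments and the Wick formula\<close>

definition half_gaussian :: "real measure" where
  "half_gaussian = density lborel (normal_density 0 (sqrt (1/2)))"

lemma prob_space_half_gaussian: "prob_space half_gaussian"
  unfolding half_gaussian_def by (intro prob_space_normal_density) simp

lemma sets_half_gaussian [measurable_cong]: "sets half_gaussian = sets borel"
  by (simp add: half_gaussian_def)

lemma space_half_gaussian [simp]: "space half_gaussian = UNIV"
  by (simp add: half_gaussian_def)

lemma integrable_half_gaussian_power: "integrable half_gaussian (\<lambda>x. x ^ k :: real)"
  using integrable_normal_moment[of "sqrt (1/2)" 0 k]
  by (simp add: half_gaussian_def integrable_density)

text \<open>Integration by parts for monomials, read off from the explicit moments; the factor 1/2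
  is the variance. At \<open>k = 0\<close> the truncated \<open>k - 1\<close> is masked by the
  factor \<open>of_nat k\<close>.\<close>

lemma half_gaussian_moment_rec:
  "(\<integral>x. x ^ Suc k \<partial>half_gaussian) = of_nat k / 2 * (\<integral>x. x ^ (k - 1) \<partial>half_gaussian)"
proof -
  have m: "(\<integral>x. x ^ j \<partial>half_gaussian) = (\<integral>x. normal_density 0 (sqrt (1/2)) x * (x - 0) ^ j \<partial>lborel)"
      for j
    by (simp add: half_gaussian_def integral_density)
  have odd: "(\<integral>x. x ^ (2 * j + 1) \<partial>half_gaussian) = 0" for j
    unfolding m by (rule integral_normal_moment_odd) simp
  have even: "(\<integral>x. x ^ (2 * j) \<partial>half_gaussian) = fact (2 * j) / (4 ^ j * fact j)" for j
    unfolding m by (subst integral_normal_moment_even) simp_all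
  show ?thesis
  proof (cases "even k")
    case True
    then obtain j where j: "k = 2 * j" by (elim evenE)
    show ?thesis
    proof (cases j)
      case 0
      then show ?thesis using odd[of 0] j by simp
    next
      case (Suc i)
      then have "Suc k = 2 * j + 1" "k - 1 = 2 * i + 1"
        using j by auto
      then show ?thesis by (simp only: odd)
    qed
  next
    case False
    then obtain j where j: "k = 2 * j + 1" by (elim oddE)
    then have "Suc k = 2 * (j + 1)" "k - 1 = 2 * j"
      by auto
    then have m1: "(\<integral>x. x ^ Suc k \<partial>half_gaussian) = fact (2 * (j + 1)) / (4 ^ (j + 1) * fact (j + 1))"
      "(\<integral>x. x ^ (k - 1) \<partial>half_gaussian) = fact (2 * j) / (4 ^ j * fact j)"
      by (simp_all only: even)
    show ?thesis
      unfolding m1 unfolding j by (simp add: divide_simps)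
  qed
qed

text \<open>Linearity extends the recursion from monomials. The coefficients are complex because a
  monomial in \<open>z\<close> and \<open>cnj z\<close> with one coordinate frozen is a complex
  polynomial in the other.\<close>

lemma half_gaussian_by_parts:
  fixes q :: "complex poly"
  shows "integrable half_gaussian (\<lambda>x. poly q (of_real x))"
    and "(\<integral>x. of_real x * poly q (of_real x) \<partial>half_gaussian) =
      (\<integral>x. poly (pderiv q) (of_real x) \<partial>half_gaussian) / 2"
proof -
  have pow: "integrable half_gaussian (\<lambda>x. c * complex_of_real x ^ k)"
    and pow_int: "(\<integral>x. c * complex_of_real x ^ k \<partial>half_gaussian) = c
        * of_real (\<integral>x. x ^ k \<partial>half_gaussian)" for c k
    using integrable_half_gaussian_power[of k]
    by (simp_all flip: of_real_power)
  have int: "integrable half_gaussian (\<lambda>x. poly p (of_real x))" for p :: "complex poly"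
    unfolding poly_altdef by (intro Bochner_Integration.integrable_sum pow)
  then show "integrable half_gaussian (\<lambda>x. poly q (of_real x))" .
  have int': "integrable half_gaussian (\<lambda>x. of_real x * poly p (of_real x))" for p :: "complex poly"
    using int[of "pCons 0 p"] by simp
  have monom: "(\<integral>x. of_real x * poly (monom c k) (of_real x) \<partial>half_gaussian) =
      (\<integral>x. poly (pderiv (monom c k)) (of_real x) \<partial>half_gaussian) / 2" for c :: complex and k
  proof -
    have "(\<integral>x. of_real x * poly (monom c k) (of_real x) \<partial>half_gaussian) =
        (\<integral>x. c * complex_of_real x ^ Suc k \<partial>half_gaussian)"
      by (simp add: poly_monom mult_ac)
    also have "\<dots> = c * of_real (of_nat k / 2 * (\<integral>x. x ^ (k - 1) \<partial>half_gaussian))"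
      by (simp only: pow_int half_gaussian_moment_rec)
    also have "\<dots> = (\<integral>x. (of_nat k * c) * complex_of_real x ^ (k - 1) \<partial>half_gaussian) / 2"
      unfolding pow_int by simp
    also have "\<dots> = (\<integral>x. poly (pderiv (monom c k)) (of_real x) \<partial>half_gaussian) / 2"
      by (simp add: pderiv_monom poly_monom)
    finally show ?thesis .
  qed
  have "(\<integral>x. of_real x * poly (\<Sum>i\<in>A. monom (coeff q i) i) (of_real x) \<partial>half_gaussian) =
      (\<integral>x. poly (pderiv (\<Sum>i\<in>A. monom (coeff q i) i)) (of_real x) \<partial>half_gaussian) / 2"
    if "finite A" for A
    using that
  proof induction
    case (insert a A)
    then have "(\<integral>x. of_real x * poly (\<Sum>i\<in>insert a A. monom (coeff q i) i) (of_real x)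
        \<partial>half_gaussian) =
        (\<integral>x. of_real x * poly (monom (coeff q a) a) (of_real x) \<partial>half_gaussian) +
        (\<integral>x. of_real x * poly (\<Sum>i\<in>A. monom (coeff q i) i) (of_real x) \<partial>half_gaussian)"
      by (simp add: distrib_left int' del: poly_sum)
    also have "\<dots> = ((\<integral>x. poly (pderiv (monom (coeff q a) a)) (of_real x) \<partial>half_gaussian) +
        (\<integral>x. poly (pderiv (\<Sum>i\<in>A. monom (coeff q i) i)) (of_real x) \<partial>half_gaussian)) / 2"
      unfolding monom insert.IH by (rule add_divide_distrib[symmetric])
    finally show ?case
      using insert.hyps by (simp add: pderiv_add int)
  qed simp
  from this[of "{..degree q}"] show "(\<integral>x. of_real x * poly q (of_real x) \<partial>half_gaussian) =
      (\<integral>x. poly (pderiv q) (of_real x) \<partial>half_gaussian) / 2"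
    by (simp add: poly_as_sum_of_monoms)
qed

interpretation half_gaussian: prob_space half_gaussian
  by (rule prob_space_half_gaussian)

interpretation half_gaussian2: pair_prob_space half_gaussian half_gaussian ..

lemma complex_gaussian_altdef:
  "complex_gaussian = distr (half_gaussian \<Otimes>\<^sub>M half_gaussian) borel (\<lambda>p. Complex (fst p) (snd p))"
  by (simp add: complex_gaussian_def half_gaussian_def case_prod_unfold)

lemma measurable_Complex [measurable]: 
  "(\<lambda>p. Complex (fst p) (snd p)) \<in> borel_measurable (half_gaussian \<Otimes>\<^sub>M half_gaussian)"
  unfolding Complex_eq by measurable

lemma prob_space_complex_gaussian: "prob_space complex_gaussian"
  unfolding complex_gaussian_altdef by (rule half_gaussian2.prob_space_distr) simp

lemma borel_measurable_monomial [measurable]: "(\<lambda>z. z ^ a * cnj z ^ b) \<in> borel_measurable borel"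
  by (intro borel_measurable_continuous_onI continuous_intros)

lemma integrable_half_gaussian_monomial:
  "integrable (half_gaussian \<Otimes>\<^sub>M half_gaussian)
     (\<lambda>p. Complex (fst p) (snd p) ^ a * cnj (Complex (fst p) (snd p)) ^ b)"
proof -
  \<comment> \<open>A dominating function of product form: for \<open>z = Complex x y\<close>,
    \<open>norm z\<close> is at most \<open>1 + x^2 + y^2\<close>, hence at most
    \<open>(1 + x^2) * (1 + y^2)\<close>. Integrability thus reduces to moments in one
    dimension.\<close>
  define h where "h x = (1 + x\<^sup>2) ^ (a + b)" for x :: real
  have h: "integrable half_gaussian h"
  proof -
    have "h = (\<lambda>x. \<Sum>k\<le>a + b. of_nat ((a + b) choose k) * x ^ (2 * k))"
      by (auto simp: h_def binomial_ring[of "x\<^sup>2" 1 for x] power_mult add.commute[of 1])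
    then show ?thesis
      by (simp add: integrable_half_gaussian_power)
  qed
  have h0: "h x \<ge> 0" for x
    by (simp add: h_def)
  have [measurable]: "h \<in> borel_measurable borel"
    unfolding h_def by measurable
  have "integrable (half_gaussian \<Otimes>\<^sub>M half_gaussian) (\<lambda>p. h (fst p) * h (snd p))"
    using h h0 by (intro half_gaussian2.Fubini_integrable) (auto simp: abs_mult)
  then show ?thesis
  proof (rule Bochner_Integration.integrable_bound)
    have "norm (Complex x y ^ a * cnj (Complex x y) ^ b) \<le> norm (h x * h y)" for x y
    proof -
      have "norm (Complex x y) \<le> 1 + (norm (Complex x y))\<^sup>2"
        using sum_squares_bound[of 1 "norm (Complex x y)"] norm_ge_zero[of "Complex x y"]
        by (simp only: power2_eq_square)
      also have "\<dots> \<le> (1 + x\<^sup>2) * (1 + y\<^sup>2)"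
        by (simp add: cmod_power2 algebra_simps)
      finally have "norm (Complex x y) ^ (a + b) \<le> ((1 + x\<^sup>2) * (1 + y\<^sup>2)) ^ (a + b)"
        by (intro power_mono) auto
      then show ?thesis
        by (simp add: norm_mult norm_power power_add h_def power_mult_distrib mult_ac)
    qed
    then show "AE p in half_gaussian \<Otimes>\<^sub>M half_gaussian.
        norm (Complex (fst p) (snd p) ^ a * cnj (Complex (fst p) (snd p)) ^ b) \<le> norm (h (fst p)
            * h (snd p))"
      by (intro AE_I2) simp
  qed (rule measurable_compose[OF measurable_Complex borel_measurable_monomial])
qed

lemma integrable_complex_gaussian: "integrable complex_gaussian (\<lambda>z. z ^ a * cnj z ^ b)"
  unfolding complex_gaussian_altdef
  by (subst integrable_distr_eq) (auto intro: integrable_half_gaussian_monomial)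

definition gaussian_moment :: "nat \<Rightarrow> nat \<Rightarrow> complex" where
  "gaussian_moment a b = (\<integral>z. z ^ a * cnj z ^ b \<partial>complex_gaussian)"

lemma gaussian_moment_altdef:
  "gaussian_moment a b = (\<integral>p. Complex (fst p) (snd p) ^ a * cnj (Complex (fst p) (snd p)) ^ b
     \<partial>(half_gaussian \<Otimes>\<^sub>M half_gaussian))"
  unfolding gaussian_moment_def complex_gaussian_altdef by (subst integral_distr) auto

text \<open>Gaussian integration by parts: with \<open>2 \<partial>/\<partial>\<bar>z = \<partial>/\<partial>x + \<i> \<partial>/\<partial>y\<close>,
  \<open>E (z f) = E (\<partial>f/\<partial>\<bar>z)\<close>.\<close>
lemma gaussian_moment_Suc: "gaussian_moment (Suc a) b = of_nat b * gaussian_moment a (b - 1)"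
proof -
  let ?H = "half_gaussian \<Otimes>\<^sub>M half_gaussian"
  define F where "F a b p = Complex (fst p) (snd p) ^ a * cnj (Complex (fst p) (snd p)) ^ b" for a b p
  have M: "gaussian_moment a b = (\<integral>p. F a b p \<partial>?H)" for a b
    by (simp add: gaussian_moment_altdef F_def)
  have F: "integrable ?H (F a b)" for a b
    unfolding F_def by (rule integrable_half_gaussian_monomial)
  have m [measurable]: "F a b \<in> borel_measurable ?H" for a b
    using F by (rule borel_measurable_integrable)
  \<comment> \<open>In terms of \<open>z\<close> and its conjugate, multiplication by a coordinate
    yields a combination of monomials, whose integrability is known.\<close>
  have re: "of_real (fst p) = (Complex (fst p) (snd p) + cnj (Complex (fst p) (snd p))) / 2"
    and im: "of_real (snd p) = (Complex (fst p) (snd p) - cnj (Complex (fst p) (snd p))) / (2 * \<i>)"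
        for p
    by (simp_all add: complex_eq_iff Re_divide Im_divide)
  have xF: "integrable ?H (\<lambda>p. of_real (fst p) * F a b p)" 
  proof -
    have "(\<lambda>p. of_real (fst p) * F a b p) = (\<lambda>p. (F (Suc a) b p + F a (Suc b) p) / 2)"
      unfolding re by (simp add: F_def field_simps)
    then show ?thesis using F by simp
  qed
  have yF: "integrable ?H (\<lambda>p. of_real (snd p) * F a b p)"
  proof -
    have "(\<lambda>p. of_real (snd p) * F a b p) = (\<lambda>p. (F (Suc a) b p - F a (Suc b) p) / (2 * \<i>))"
      unfolding im by (simp add: F_def field_simps)
    then show ?thesis using F by simp
  qed
  define A where "A = of_nat a * gaussian_moment (a - 1) b"
  define B where "B = of_nat b * gaussian_moment a (b - 1)"
  have "(\<integral>p. of_real (fst p) * F a b p \<partial>?H) = (\<integral>y. \<integral>x. of_real x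
      * F a b (x, y) \<partial>half_gaussian \<partial>half_gaussian)"
    using half_gaussian2.integral_snd[of "\<lambda>x y. of_real x * F a b (x, y)"] xF
        by (simp add: case_prod_unfold)
  also have "\<dots> = (\<integral>y. \<integral>x. (of_nat a * F (a - 1) b (x, y) + of_nat b
      * F a (b - 1) (x, y)) / 2 \<partial>half_gaussian \<partial>half_gaussian)"
  proof (rule Bochner_Integration.integral_cong[OF refl])
    fix y
    \<comment> \<open>For frozen \<open>y\<close> the monomial is a polynomial in \<open>x\<close>,
      and the product rule turns its derivative into the two lower monomials.\<close>
    define q where "q = [:\<i> * of_real y, 1:] ^ a * [:- \<i> * of_real y, 1:] ^ b"
    have Fq: "F a b (x, y) = poly q (of_real x)" for x
      by (simp add: F_def q_def Complex_eq algebra_simps)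
    have Fq': "of_nat a * F (a - 1) b (x, y) + of_nat b * F a (b - 1) (x, y)
        = poly (pderiv q) (of_real x)" for x
      by (simp add: F_def q_def Complex_eq pderiv_mult pderiv_power pderiv_pCons algebra_simps)
    show "(\<integral>x. of_real x * F a b (x, y) \<partial>half_gaussian) =
        (\<integral>x. (of_nat a * F (a - 1) b (x, y) + of_nat b * F a (b - 1) (x, y)) / 2 \<partial>half_gaussian)"
      unfolding Fq Fq' by (simp add: half_gaussian_by_parts(2))
  qed
  also have "\<dots> = (\<integral>p. (of_nat a * F (a - 1) b p + of_nat b * F a (b - 1) p) / 2 \<partial>?H)"
    using half_gaussian2.integral_snd[of "\<lambda>x y. (of_nat a * F (a - 1) b (x, y) + of_nat b
        * F a (b - 1) (x, y)) / 2"] F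
    by (simp add: case_prod_unfold)
  also have "\<dots> = (A + B) / 2"
    using F by (simp add: M A_def B_def)
  finally have x: "(\<integral>p. of_real (fst p) * F a b p \<partial>?H) = (A + B) / 2" .
  have "(\<integral>p. of_real (snd p) * F a b p \<partial>?H) = (\<integral>x. \<integral>y. of_real y
      * F a b (x, y) \<partial>half_gaussian \<partial>half_gaussian)"
    using half_gaussian2.integral_fst'[of "\<lambda>p. of_real (snd p) * F a b p"] yF by simp
  also have "\<dots> = (\<integral>x. \<integral>y. (\<i> * of_nat a * F (a - 1) b (x, y) - \<i> * of_nat b
      * F a (b - 1) (x, y)) / 2 \<partial>half_gaussian \<partial>half_gaussian)"
  proof (rule Bochner_Integration.integral_cong[OF refl])
    fix x
    define q where "q = [:of_real x, \<i>:] ^ a * [:of_real x, - \<i>:] ^ b"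
    have Fq: "F a b (x, y) = poly q (of_real y)" for y
      by (simp add: F_def q_def Complex_eq algebra_simps)
    have Fq': "\<i> * of_nat a * F (a - 1) b (x, y) - \<i> * of_nat b * F a (b - 1) (x, y)
        = poly (pderiv q) (of_real y)" for y
      by (simp add: F_def q_def Complex_eq pderiv_mult pderiv_power pderiv_pCons algebra_simps)
    show "(\<integral>y. of_real y * F a b (x, y) \<partial>half_gaussian) =
        (\<integral>y. (\<i> * of_nat a * F (a - 1) b (x, y) - \<i> * of_nat b
            * F a (b - 1) (x, y)) / 2 \<partial>half_gaussian)"
      unfolding Fq Fq' by (simp add: half_gaussian_by_parts(2))
  qed
  also have "\<dots> = (\<integral>p. (\<i> * of_nat a * F (a - 1) b p - \<i> * of_nat b * F a (b - 1) p) / 2 \<partial>?H)"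
    using half_gaussian2.integral_fst'[of "\<lambda>p. (\<i> * of_nat a * F (a - 1) b p - \<i> * of_nat b
        * F a (b - 1) p) / 2"] F
    by simp
  also have "\<dots> = (\<i> * A - \<i> * B) / 2"
    using F by (simp add: M A_def B_def mult.assoc)
  finally have y: "(\<integral>p. of_real (snd p) * F a b p \<partial>?H) = (\<i> * A - \<i> * B) / 2" .
  have "gaussian_moment (Suc a) b = (\<integral>p. of_real (fst p) * F a b p + \<i> * (of_real (snd p)
      * F a b p) \<partial>?H)"
    unfolding M by (intro Bochner_Integration.integral_cong refl) (simp add: F_def Complex_eq
        algebra_simps)
  \<comment> \<open>The \<open>A\<close> terms, which stem from differentiating the powers of
    \<open>z\<close>, cancel; the \<open>B\<close> terms add up.\<close>
  also have "\<dots> = (A + B) / 2 + \<i> * ((\<i> * A - \<i> * B) / 2)"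
    using xF yF by (simp add: x y)
  also have "\<dots> = B"
    by (simp add: algebra_simps diff_divide_distrib add_divide_distrib flip: mult.assoc)
  finally show ?thesis
    by (simp add: B_def)
qed

lemma gaussian_moment_eq: "gaussian_moment a b = (if a = b then fact a else 0)"
proof (induction a arbitrary: b)
  case 0
  show ?case
  proof (cases b)
    case 0
    then show ?thesis
      using prob_space.prob_space[OF prob_space_complex_gaussian] by (simp add: gaussian_moment_def)
  next
    case (Suc c)
    \<comment> \<open>Conjugation swaps the exponents, after which the recursion applies with factor
      0.\<close>
    have "gaussian_moment 0 b = cnj (gaussian_moment b 0)"
      unfolding gaussian_moment_def by (simp flip: Bochner_Integration.integral_cnj)
    then show ?thesis
      using Suc by (simp add: gaussian_moment_Suc)
  qed
next
  case (Suc a)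
  then show ?case
    by (cases b) (simp_all add: gaussian_moment_Suc)
qed

section \<open>Wick pairings counted as matching bijections\<close>

text \<open>Domain and target are separate sets because the induction removes a point from one and
  its image from the other. Extensionality makes the set finite and restrictions canonical.\<close>

definition matching_bijections :: "'a set \<Rightarrow> 'a set \<Rightarrow> ('a \<Rightarrow> 'b) \<Rightarrow> ('a \<Rightarrow> 'b) \<Rightarrow> ('a \<Rightarrow> 'a) set" where
  "matching_bijections T S X Y = {f \<in> T \<rightarrow>\<^sub>E S. bij_betw f T S \<and> (\<forall>t\<in>T. X (f t) = Y t)}"

lemma card_matching_bijections_insert:
  assumes "finite T" "finite S" "t \<notin> T"
  shows "card (matching_bijections (insert t T) S X Y) =
    (\<Sum>s\<in>{s\<in>S. X s = Y t}. card (matching_bijections T (S - {s}) X Y))"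
proof -
  let ?A = "SIGMA s:{s\<in>S. X s = Y t}. matching_bijections T (S - {s}) X Y"
  have "bij_betw (\<lambda>(s, f). f(t := s)) ?A (matching_bijections (insert t T) S X Y)"
  proof (rule bij_betwI[where g = "\<lambda>f. (f t, restrict f T)"], goal_cases)
    case 1
    show ?case
    proof (rule Pi_I, clarify)
      fix s f assume s: "s \<in> S" "X s = Y t" and f: "f \<in> matching_bijections T (S - {s}) X Y"
      have "bij_betw (f(t := s)) T (S - {s})"
        using f assms(3) by (subst bij_betw_cong[of T _ f]) (auto simp: matching_bijections_def)
      then have "bij_betw (f(t := s)) (insert t T) (insert s (S - {s}))"
        using notIn_Un_bij_betw[of t T "f(t := s)" "S - {s}"] assms(3) by simp
      then show "f(t := s) \<in> matching_bijections (insert t T) S X Y"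
        using s f assms(3) by (auto simp: matching_bijections_def insert_absorb PiE_iff
            extensional_def)
    qed
  next
    case 2
    show ?case
    proof (rule Pi_I)
      fix f assume f: "f \<in> matching_bijections (insert t T) S X Y"
      then have "bij_betw f (insert t T) S"
        by (simp add: matching_bijections_def)
      moreover have "insert (f t) S = S"
        using f by (auto simp: matching_bijections_def)
      ultimately have "bij_betw f T (S - {f t})"
        using notIn_Un_bij_betw3[of t T f "S - {f t}"] assms(3) by simp
      moreover from this have "bij_betw (restrict f T) T (S - {f t})"
        by (subst bij_betw_cong[of T _ f]) auto
      ultimately show "(f t, restrict f T) \<in> ?A"
        using f bij_betw_imp_surj_on[of f T "S - {f t}"] by (auto simp: matching_bijections_def)
    qed
  next
    case (3 x)
    then show ?case
      using assms(3) by (auto simp: matching_bijections_def PiE_iff extensional_def fun_eq_iff)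
  next
    case (4 f)
    then show ?case
      by (auto simp: matching_bijections_def PiE_iff extensional_def fun_eq_iff)
  qed
  moreover have "finite (matching_bijections T (S - {s}) X Y)" for s
    using assms by (intro finite_subset[OF _ finite_PiE[of T "\<lambda>_. S - {s}"]]) (auto simp:
        matching_bijections_def)
  ultimately show ?thesis
    using assms by (simp flip: bij_betw_same_card)
qed

text \<open>A matching bijection maps each fibre of \<open>Y\<close> onto the fibre of
  \<open>X\<close> over the same value, in factorially many ways. The induction chooses the image of
  one point, which changes only the factor at \<open>e0\<close>.\<close>

lemma prod_fact_eq_card_matching_bijections:
  assumes I: "finite I" and "finite T" "finite S" "X ` S \<subseteq> I" "Y ` T \<subseteq> I"
  shows "(\<Prod>e\<in>I. if card {s\<in>S. X s = e} = card {t\<in>T. Y t = e} then fact (card {s\<in>S. X s = e}) else 0) =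
    card (matching_bijections T S X Y)"
  using assms(2-)
proof (induction T arbitrary: S)
  case empty
  show ?case
  proof (cases "S = {}")
    case True
    have "matching_bijections {} {} X Y = {\<lambda>x. undefined}"
      by (auto simp: matching_bijections_def bij_betw_def)
    then show ?thesis
      using True by simp
  next
    case False
    then obtain s where "s \<in> S" by blast
    have "(\<Prod>e\<in>I. if card {s\<in>S. X s = e} = card {t\<in>{}. Y t = e} then fact (card {s\<in>S. X s
        = e}) else 0) = (0::nat)"
      using I empty \<open>s \<in> S\<close> by (intro prod_zero[OF I] bexI[of _ "X s"]) (auto simp: card_eq_0_iff)
    moreover have "matching_bijections {} S X Y = {}"
      using False by (auto simp: matching_bijections_def bij_betw_def)
    ultimately show ?thesis by simp
  qed
next
  case (insert t T)
  define e0 where "e0 = Y t"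
  have e0: "e0 \<in> I"
    using insert by (auto simp: e0_def)
  define A where "A S e = card {s\<in>S. X s = e}" for S e
  define B where "B T e = card {t\<in>T. Y t = e}" for T e
  define R where "R = (\<Prod>e\<in>I - {e0}. if A S e = B T e then fact (A S e) else 0 :: nat)"
  have BT: "B (insert t T) e = (if e = e0 then Suc (B T e) else B T e)" for e
  proof -
    have "{u \<in> insert t T. Y u = e} = (if e = e0 then insert t {u \<in> T. Y u = e} else {u \<in> T. Y u
        = e})"
      by (auto simp: e0_def)
    then show ?thesis
      using insert.hyps by (simp add: B_def)
  qed
  have AS: "A (S - {s}) e = (if e = e0 then A S e - 1 else A S e)" if "s \<in> S" "X s = e0" for s e
  proof -
    have "{u \<in> S - {s}. X u = e} = (if e = e0 then {u \<in> S. X u = e} - {s} else {u \<in> S. X u = e})"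
      using that by auto
    then show ?thesis
      using that insert.prems by (simp add: A_def)
  qed
  have "card (matching_bijections T (S - {s}) X Y) = (if A S e0 - 1
      = B T e0 then fact (A S e0 - 1) else 0) * R"
    if s: "s \<in> S" "X s = e0" for s
  proof -
    have "card (matching_bijections T (S - {s}) X Y) =
        (\<Prod>e\<in>I. if A (S - {s}) e = B T e then fact (A (S - {s}) e) else 0)"
      unfolding A_def B_def using insert.prems by (intro insert.IH[symmetric]) auto
    also have "\<dots> = (if A S e0 - 1 = B T e0 then fact (A S e0 - 1) else 0) * R"
    proof -
      have "(\<Prod>e\<in>I - {e0}. if A (S - {s}) e = B T e then fact (A (S - {s}) e) else 0) = R"
        unfolding R_def by (intro prod.cong refl) (simp add: AS[OF s])
      then show ?thesis
        by (subst prod.remove[OF I e0]) (simp add: AS[OF s])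
    qed
    finally show ?thesis .
  qed
  then have "card (matching_bijections (insert t T) S X Y) =
      A S e0 * ((if A S e0 - 1 = B T e0 then fact (A S e0 - 1) else 0) * R)"
    using insert.hyps insert.prems by (simp add: card_matching_bijections_insert e0_def A_def)
  \<comment> \<open>The truncated \<open>A S e0 - 1\<close> does no harm at
    \<open>A S e0 = 0\<close>, where the leading factor vanishes.\<close>
  also have "\<dots> = (if A S e0 = Suc (B T e0) then fact (A S e0) else 0) * R"
    by (cases "A S e0") (auto simp: algebra_simps)
  also have "\<dots> = (\<Prod>e\<in>I. if A S e = B (insert t T) e then fact (A S e) else 0)"
    by (subst prod.remove[OF I e0]) (auto simp: R_def BT intro!: prod.cong)
  finally show ?case
    unfolding A_def B_def by (rule sym)
qed

lemma card_matching_permutations: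
  "card {f. f permutes S \<and> (\<forall>s\<in>S. X (f s) = Y s)} = card (matching_bijections S S X Y)"
proof -
  have "bij_betw (\<lambda>f. restrict f S) {f. f permutes S \<and> (\<forall>s\<in>S. X (f s)
      = Y s)} (matching_bijections S S X Y)"
  proof (rule bij_betwI[where g = "\<lambda>f x. if x \<in> S then f x else x"], goal_cases)
    case 1
    have "bij_betw (restrict f S) S S" if "f permutes S" for f
      using permutes_imp_bij[OF that] by (subst bij_betw_cong[of S _ f]) auto
    then show ?case
      by (auto simp: matching_bijections_def permutes_in_image)
  next
    case 2
    have "(\<lambda>x. if x \<in> S then f x else x) permutes S" if "bij_betw f S S" for f
    proof (rule bij_imp_permutes)
      show "bij_betw (\<lambda>x. if x \<in> S then f x else x) S S"
        using that by (subst bij_betw_cong[of S _ f]) auto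
    qed auto
    then show ?case
      by (auto simp: matching_bijections_def)
  next
    case (3 f)
    then show ?case
      by (auto simp: fun_eq_iff permutes_not_in)
  next
    case (4 f)
    then show ?case
      by (auto simp: matching_bijections_def PiE_iff extensional_def fun_eq_iff)
  qed
  then show ?thesis
    by (rule bij_betw_same_card)
qed

text \<open>Grouping the factors by matrix entry and using independence gives a product of
  single-entry moments. The moment at an entry counts the bijections between the fibres of
  \<open>X\<close> and \<open>Y\<close> over it.\<close>

lemma
  assumes S: "finite S" and X: "X ` S \<subseteq> {0..<N} \<times> {0..<M}" and Y: "Y ` S \<subseteq> {0..<N} \<times> {0..<M}"
  shows integrable_gaussian_product:
      "integrable (gaussian_matrix_space N M) (\<lambda>g. \<Prod>s\<in>S. g (X s) * cnj (g (Y s)))"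
    and wick_formula:
      "(\<integral>g. (\<Prod>s\<in>S. g (X s) * cnj (g (Y s))) \<partial>gaussian_matrix_space N M) =
        of_nat (card {f. f permutes S \<and> (\<forall>s\<in>S. X (f s) = Y s)})"
proof -
  define I where "I = {0..<N} \<times> {0..<M}"
  have I: "finite I"
    by (simp add: I_def)
  define a where "a e = card {s\<in>S. X s = e}" for e
  define b where "b e = card {s\<in>S. Y s = e}" for e
  have eq: "(\<Prod>s\<in>S. g (X s) * cnj (g (Y s))) = (\<Prod>e\<in>I. g e ^ a e * cnj (g e) ^ b e)"
      for g :: "nat \<times> nat \<Rightarrow> complex"
  proof -
    have "(\<Prod>s\<in>S. h (Z s)) = (\<Prod>e\<in>I. h e ^ card {s\<in>S. Z s = e})" if "Z ` S \<subseteq> I"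
      for Z and h :: "nat \<times> nat \<Rightarrow> complex"
    proof -
      have "(\<Prod>s\<in>S. h (Z s)) = (\<Prod>e\<in>I. \<Prod>s\<in>{s\<in>S. Z s = e}. h (Z s))"
        using prod.group[OF S I that, of "\<lambda>s. h (Z s)"] by simp
      also have "\<dots> = (\<Prod>e\<in>I. h e ^ card {s\<in>S. Z s = e})"
        by (intro prod.cong) auto
      finally show ?thesis .
    qed
    from this[of X g] this[of Y "\<lambda>e. cnj (g e)"] show ?thesis
      using X Y by (simp add: prod.distrib a_def b_def I_def)
  qed
  interpret product_sigma_finite "\<lambda>_::nat \<times> nat. complex_gaussian"
    using prob_space_complex_gaussian
    by (auto simp: product_sigma_finite_def intro: prob_space_imp_sigma_finite)
  have int: "integrable complex_gaussian (\<lambda>z. z ^ a e * cnj z ^ b e)" for e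
    by (rule integrable_complex_gaussian)
  show "integrable (gaussian_matrix_space N M) (\<lambda>g. \<Prod>s\<in>S. g (X s) * cnj (g (Y s)))"
    unfolding eq gaussian_matrix_space_def I_def[symmetric]
    by (rule product_integrable_prod[OF I int])
  have "(\<integral>g. (\<Prod>s\<in>S. g (X s) * cnj (g (Y s))) \<partial>gaussian_matrix_space N M)
      = (\<Prod>e\<in>I. gaussian_moment (a e) (b e))"
    unfolding eq gaussian_matrix_space_def I_def[symmetric] gaussian_moment_def
    by (rule product_integral_prod[OF I int])
  also have "\<dots> = of_nat (\<Prod>e\<in>I. if a e = b e then fact (a e) else 0)"
    by (simp add: gaussian_moment_eq of_nat_prod if_distrib[of of_nat] cong: if_cong)
  also have "(\<Prod>e\<in>I. if a e = b e then fact (a e) else 0) = card (matching_bijections S S X Y)"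
    unfolding a_def b_def using I S X Y by (intro prod_fact_eq_card_matching_bijections) (auto simp:
        I_def)
  finally show "(\<integral>g. (\<Prod>s\<in>S. g (X s) * cnj (g (Y s))) \<partial>gaussian_matrix_space N M) =
        of_nat (card {f. f permutes S \<and> (\<forall>s\<in>S. X (f s) = Y s)})"
    by (simp add: card_matching_permutations)
qed

subsection \<open>Moments of the partial transpose\<close>

lemma sum_PiE_insert:
  assumes "finite S" "x \<notin> S"
  shows "(\<Sum>f\<in>insert x S \<rightarrow>\<^sub>E K. h f) = (\<Sum>k\<in>K. \<Sum>f\<in>S \<rightarrow>\<^sub>E K. h (f(x := k)))"
proof -
  have "(\<Sum>f\<in>insert x S \<rightarrow>\<^sub>E K. h f) = (\<Sum>(k, f)\<in>K \<times> (S \<rightarrow>\<^sub>E K). h (f(x := k)))"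
    unfolding PiE_insert_eq using inj_combinator[OF assms(2), of "\<lambda>_. K"]
    by (subst sum.reindex) (simp_all add: case_prod_unfold)
  also have "\<dots> = (\<Sum>k\<in>K. \<Sum>f\<in>S \<rightarrow>\<^sub>E K. h (f(x := k)))"
    by (rule sum.cartesian_product[symmetric])
  finally show ?thesis .
qed

text \<open>The path \<open>f\<close> lists the row indices of the factors. Its start is fixed by a
  conditional rather than by the domain, so that summing over \<open>i\<close> in the trace closes
  the path without reindexing.\<close>

lemma pow_mat_index:
  fixes A :: "'a::comm_ring_1 mat"
  assumes A: "A \<in> carrier_mat N N" and "i < N" "j < N"
  shows "(A ^\<^sub>m Suc p) $$ (i, j) = (\<Sum>f\<in>{1..Suc p} \<rightarrow>\<^sub>E {..<N}.
    if f 1 = i then (\<Prod>s\<in>{1..p}. A $$ (f s, f (Suc s))) * A $$ (f (Suc p), j) else 0)"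
  using assms(3)
proof (induction p arbitrary: j)
  case 0
  have "(\<Sum>f\<in>{1..Suc 0} \<rightarrow>\<^sub>E {..<N}.
      if f 1 = i then (\<Prod>s\<in>{1..0}. A $$ (f s, f (Suc s))) * A $$ (f (Suc 0), j) else 0) =
      (\<Sum>k<N. if k = i then A $$ (k, j) else 0)"
  proof -
    have "{1..Suc 0} = insert (Suc 0) {}"
      by auto
    then show ?thesis
      by (simp only: sum_PiE_insert finite.emptyI empty_iff not_False_eq_True PiE_empty_domain) simp
  qed
  then show ?case
    using A assms(2) 0 by (simp add: left_mult_one_mat[OF A])
next
  case (Suc p)
  let ?T = "\<lambda>p f. \<Prod>s\<in>{1..p}. A $$ (f s, f (Suc s))"
  have "(A ^\<^sub>m Suc (Suc p)) $$ (i, j) = (\<Sum>k<N. (A ^\<^sub>m Suc p) $$ (i, k) * A $$ (k, j))"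
    using A assms(2) Suc.prems pow_carrier_mat[OF A, of "Suc p"]
    by (simp add: scalar_prod_def atLeast0LessThan del: pow_mat.simps add: pow_mat.simps(2)[of A
        "Suc p"])
  also have "\<dots> = (\<Sum>k<N. \<Sum>f\<in>{1..Suc p} \<rightarrow>\<^sub>E {..<N}. if f 1 = i then ?T p f * A $$ (f (Suc p), k)
      * A $$ (k, j) else 0)"
  proof (intro sum.cong refl)
    fix k assume "k \<in> {..<N}"
    then have "(A ^\<^sub>m Suc p) $$ (i, k) = (\<Sum>f\<in>{1..Suc p} \<rightarrow>\<^sub>E {..<N}. if f 1 = i then ?T p f
        * A $$ (f (Suc p), k) else 0)"
      by (intro Suc.IH) simp
    then show "(A ^\<^sub>m Suc p) $$ (i, k) * A $$ (k, j) =
        (\<Sum>f\<in>{1..Suc p} \<rightarrow>\<^sub>E {..<N}. if f 1 = i then ?T p f * A $$ (f (Suc p), k) * A $$ (k, j) else 0)"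
      by (simp only: sum_distrib_right if_distrib[of "\<lambda>x. x * _"] mult_zero_left)
  qed
  also have "\<dots> = (\<Sum>f\<in>insert (Suc (Suc p)) {1..Suc p} \<rightarrow>\<^sub>E {..<N}.
      if f 1 = i then ?T (Suc p) f * A $$ (f (Suc (Suc p)), j) else 0)"
  proof (subst sum_PiE_insert, goal_cases)
    case 3
    have "?T p (f(Suc (Suc p) := k)) = ?T p f" for f k
      by (intro prod.cong) auto
    then show ?case
      by (simp cong: if_cong)
  qed auto
  also have "insert (Suc (Suc p)) {1..Suc p} = {1..Suc (Suc p)}"
    by auto
  finally show ?case .
qed

lemma cyc_succ_atLeastAtMost:
  assumes "s \<in> {1..p}"
  shows "cyc_succ {1..p} s = (if s = p then 1 else Suc s)"
proof (cases "s = p")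
  case True
  have "cyc_succ {1..p} s = 1"
    by (rule cyc_succ_eq_MinI) (use assms True in auto)
  then show ?thesis using True by simp
next
  case False
  have "cyc_succ {1..p} s = Suc s"
    by (rule cyc_succ_eqI) (use assms False in auto)
  then show ?thesis using False by simp
qed

lemma trace_pow_mat:
  fixes A :: "'a::comm_ring_1 mat"
  assumes A: "A \<in> carrier_mat N N" and p: "p \<ge> 1"
  shows "(\<Sum>i<N. (A ^\<^sub>m p) $$ (i, i)) =
    (\<Sum>f\<in>{1..p} \<rightarrow>\<^sub>E {..<N}. \<Prod>s\<in>{1..p}. A $$ (f s, f (cyc_succ {1..p} s)))"
proof -
  obtain q where q: "p = Suc q"
    using p by (cases p) auto
  have "(\<Sum>i<N. (A ^\<^sub>m p) $$ (i, i)) = (\<Sum>i<N. \<Sum>f\<in>{1..p} \<rightarrow>\<^sub>E {..<N}.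
      if f 1 = i then (\<Prod>s\<in>{1..q}. A $$ (f s, f (Suc s))) * A $$ (f p, i) else 0)"
    unfolding q by (intro sum.cong refl pow_mat_index[OF A]) auto
  also have "\<dots> = (\<Sum>f\<in>{1..p} \<rightarrow>\<^sub>E {..<N}. \<Sum>i<N.
      if f 1 = i then (\<Prod>s\<in>{1..q}. A $$ (f s, f (Suc s))) * A $$ (f p, i) else 0)"
    by (rule sum.swap)
  also have "\<dots> = (\<Sum>f\<in>{1..p} \<rightarrow>\<^sub>E {..<N}. \<Prod>s\<in>{1..p}. A $$ (f s, f (cyc_succ {1..p} s)))"
  proof (intro sum.cong refl)
    fix f assume "f \<in> {1..p} \<rightarrow>\<^sub>E {..<N}"
    then have "f 1 \<in> {..<N}"
      using p by (auto simp: PiE_iff)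
    moreover have "(\<Prod>s\<in>{1..p}. A $$ (f s, f (cyc_succ {1..p} s))) =
        (\<Prod>s\<in>{1..q}. A $$ (f s, f (Suc s))) * A $$ (f p, f 1)"
    proof -
      have "{1..p} = insert p {1..q}"
        using q by auto
      moreover have "(\<Prod>s\<in>{1..q}. A $$ (f s, f (cyc_succ {1..p} s)))
          = (\<Prod>s\<in>{1..q}. A $$ (f s, f (Suc s)))"
        using q by (intro prod.cong refl) (subst cyc_succ_atLeastAtMost, auto)
      moreover have "cyc_succ {1..p} p = 1"
        using p by (subst cyc_succ_atLeastAtMost) auto
      ultimately show ?thesis
        using q by (simp add: mult.commute)
    qed
    ultimately show "(\<Sum>i<N. if f 1 = i then (\<Prod>s\<in>{1..q}. A $$ (f s, f (Suc s)))
        * A $$ (f p, i) else 0) =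
        (\<Prod>s\<in>{1..p}. A $$ (f s, f (cyc_succ {1..p} s)))"
      by simp
  qed
  finally show ?thesis .
qed

text \<open>The factor \<open>m\<close> turns the normalisation \<open>1 / (d * m)\<close> into
  \<open>1 / d\<close>. Partial transposition exchanges the remainders of \<open>k\<close> and
  \<open>l\<close> and leaves the quotients in place.\<close>

lemma wishart_partial_transpose_index:
  assumes "k < d * n" "l < d * n" "m \<ge> 1"
  shows "(of_nat m \<cdot>\<^sub>m partial_transpose d n (wishart (d * n) (d * m) g)) $$ (k, l) =
    (\<Sum>c\<in>{0..<d * m}. g ((k div n) * n + l mod n, c) * cnj (g ((l div n)
        * n + k mod n, c))) / of_nat d"
    and "(k div n) * n + l mod n < d * n"
proof -
  have less: "(k div n) * n + l mod n < d * n" if "k < d * n" for k l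
  proof -
    have "n > 0" using that by (cases n) auto
    then have "k div n < d"
      using that by (simp add: less_mult_imp_div_less)
    then have "(k div n + 1) * n \<le> d * n"
      by (intro mult_right_mono) auto
    moreover have "l mod n < n"
      using \<open>n > 0\<close> by simp
    ultimately show ?thesis by (simp add: algebra_simps)
  qed
  then show "(k div n) * n + l mod n < d * n"
    using assms by blast
  have "d > 0" using assms by (cases d) auto
  then show "(of_nat m \<cdot>\<^sub>m partial_transpose d n (wishart (d * n) (d * m) g)) $$ (k, l) =
    (\<Sum>c\<in>{0..<d * m}. g ((k div n) * n + l mod n, c) * cnj (g ((l div n)
        * n + k mod n, c))) / of_nat d"
    using assms less[OF assms(1), of l] less[OF assms(2), of k]
    by (simp add: partial_transpose_def wishart_def gaussian_mat_def conj_transpose_def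
        scalar_prod_def)
qed

text \<open>Quotient and remainder by \<open>n\<close> are the two tensor components, and the
  equation splits accordingly. Quotients agree at \<open>f s\<close> and \<open>g s\<close>, which
  is invariance under \<open>g \<circ> inv_into UNIV f\<close>. Remainders have changed sides
  through the transposition, which gives invariance under \<open>g \<circ> f\<close>.\<close>

lemma card_partial_transpose_indices:
  fixes n d :: nat
  assumes f: "f permutes S" and g: "g permutes S" and S: "finite S" and n: "n \<ge> 1"
  shows "card {h \<in> S \<rightarrow>\<^sub>E {..<d * n}. \<forall>s\<in>S.
      (h (f s) div n) * n + h (g (f s)) mod n = (h (g s) div n) * n + h s mod n} =
    d ^ num_orbits (g \<circ> inv_into UNIV f) S * n ^ num_orbits (g \<circ> f) S"
proof -
  define H where "H = {h \<in> S \<rightarrow>\<^sub>E {..<d * n}. \<forall>s\<in>S.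
      (h (f s) div n) * n + h (g (f s)) mod n = (h (g s) div n) * n + h s mod n}"
  define I where "I = {h \<in> S \<rightarrow>\<^sub>E {..<d}. \<forall>s\<in>S. h ((g \<circ> inv_into UNIV f) s) = h s}"
  define J where "J = {h \<in> S \<rightarrow>\<^sub>E {..<n}. \<forall>s\<in>S. h ((g \<circ> f) s) = h s}"
  have in_S: "f s \<in> S" "g s \<in> S" "inv_into UNIV f s \<in> S" if "s \<in> S" for s
    using that f g permutes_inv[OF f] by (simp_all add: permutes_in_image)
  have I_alt: "I = {h \<in> S \<rightarrow>\<^sub>E {..<d}. \<forall>s\<in>S. h (f s) = h (g s)}"
  proof -
    have "(\<forall>s\<in>S. h ((g \<circ> inv_into UNIV f) s) = h s) \<longleftrightarrow> (\<forall>s\<in>S. h (f s) = h (g s))" for h :: "'a \<Rightarrow> nat"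
      using in_S permutes_inverses[OF f] by (metis comp_apply)
    then show ?thesis by (simp add: I_def)
  qed
  have H_alt: "H = {h \<in> S \<rightarrow>\<^sub>E {..<d * n}. (\<forall>s\<in>S. h (f s) div n = h (g s) div n)
      \<and> (\<forall>s\<in>S. h (g (f s)) mod n = h s mod n)}"
  proof -
    have "a * n + b mod n = c * n + e mod n \<longleftrightarrow> a = c \<and> b mod n = e mod n" for a b c e
    proof
      assume "a * n + b mod n = c * n + e mod n"
      then have "(a * n + b mod n) div n = (c * n + e mod n) div n" "(a * n + b mod n) mod n = (c
          * n + e mod n) mod n"
        by simp_all
      then show "a = c \<and> b mod n = e mod n"
        using n by simp
    qed simp
    then show ?thesis
      unfolding H_def by auto
  qed
  have dm: "a * n + b < d * n" if "a < d" "b < n" for a b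
  proof -
    have "(a + 1) * n \<le> d * n"
      using that by (intro mult_right_mono) auto
    then show ?thesis using that by simp
  qed
  have "bij_betw (\<lambda>(i, a). \<lambda>s\<in>S. i s * n + a s) (I \<times> J) H"
  proof (rule bij_betwI[where g = "\<lambda>h. (\<lambda>s\<in>S. h s div n, \<lambda>s\<in>S. h s mod n)"], goal_cases)
    case 1
    show ?case
    proof (rule Pi_I, clarify)
      fix i a assume i: "i \<in> I" and a: "a \<in> J"
      have less: "i s < d" "a s < n" if "s \<in> S" for s
        using i a that by (auto simp: I_def J_def PiE_iff)
      then have "(i s * n + a t) div n = i s" "(i s * n + a t) mod n = a t" if "s \<in> S" "t \<in> S" for s t
        using n that by auto
      then show "(\<lambda>s\<in>S. i s * n + a s) \<in> H"
        using i a in_S dm less unfolding H_alt I_alt J_def by auto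
    qed
  next
    case 2
    show ?case
      using n in_S unfolding H_alt I_alt J_def by (auto simp: PiE_iff less_mult_imp_div_less)
  next
    case (3 x)
    obtain i a where x: "x = (i, a)" "i \<in> I" "a \<in> J"
      using 3 by auto
    have "i s < d" "a s < n" if "s \<in> S" for s
      using x that by (auto simp: I_def J_def PiE_iff)
    then show ?case
      using x n by (auto simp: I_def J_def PiE_iff extensional_def fun_eq_iff)
  next
    case (4 h)
    then show ?case
      by (auto simp: H_def PiE_iff extensional_def fun_eq_iff)
  qed
  then have "card H = card I * card J"
    by (simp flip: bij_betw_same_card add: card_cartesian_product)
  also have "card I = d ^ num_orbits (g \<circ> inv_into UNIV f) S"
    unfolding I_def using f g S
    by (subst card_invariant_functions) (auto intro: permutes_compose permutes_inv)
  also have "card J = n ^ num_orbits (g \<circ> f) S"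
    unfolding J_def using f g S
    by (subst card_invariant_functions) (auto intro: permutes_compose)
  finally show ?thesis
    unfolding H_def .
qed

text \<open>For a fixed pairing \<open>t\<close> the conditions on the index path and on the column
  indices decouple, so the sum over pairings is moved outermost.\<close>

lemma sum_card_Collect_conj:
  assumes "finite F" "finite C" "finite T"
  shows "(\<Sum>f\<in>F. \<Sum>c\<in>C. card {t\<in>T. P f t \<and> Q c t}) = (\<Sum>t\<in>T. card {f\<in>F. P f t} * card {c\<in>C. Q c t})"
proof -
  have c: "card {x\<in>X. R x} = (\<Sum>x\<in>X. of_bool (R x))" if "finite X" for X and R :: "'x \<Rightarrow> bool"
    using that by (simp add: Int_def)
  have "(\<Sum>f\<in>F. \<Sum>c\<in>C. card {t\<in>T. P f t \<and> Q c t}) = (\<Sum>f\<in>F. \<Sum>c\<in>C. \<Sum>t\<in>T. of_bool (P f t)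
      * of_bool (Q c t))"
    using assms by (simp only: c of_bool_conj)
  also have "\<dots> = (\<Sum>t\<in>T. \<Sum>f\<in>F. \<Sum>c\<in>C. of_bool (P f t) * of_bool (Q c t))"
    by (subst sum.swap[of _ T C], subst sum.swap[of _ T F]) simp
  also have "\<dots> = (\<Sum>t\<in>T. card {f\<in>F. P f t} * card {c\<in>C. Q c t})"
    using assms by (simp only: c sum_product)
  finally show ?thesis .
qed

text \<open>An exact formula for each \<open>d\<close>. In the denominator, \<open>d * n\<close>
  normalises the trace and \<open>d ^ p\<close> collects the \<open>p\<close> factors
  \<open>1 / d\<close>.\<close>

lemma expectation_wishart_partial_transpose:
  fixes n m p d :: nat
  assumes n: "n \<ge> 1" and m: "m \<ge> 1" and p: "p \<ge> 1" and d: "d \<ge> 1"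
  defines "S \<equiv> {1..p}"
  shows "(\<integral>g. ntrace ((of_nat m \<cdot>\<^sub>m partial_transpose d n (wishart (d * n) (d * m) g)) ^\<^sub>m p)
      \<partial>gaussian_matrix_space (d * n) (d * m)) =
    (\<Sum>f | f permutes S. of_nat ((d * m) ^ num_orbits f S
        * (d ^ num_orbits (cyc_succ S \<circ> inv_into UNIV f) S * n ^ num_orbits (cyc_succ S \<circ> f) S)))
      / of_nat (d * n * d ^ p)"
proof -
  define N where "N = d * n"
  define M where "M = d * m"
  define A where "A g = of_nat m \<cdot>\<^sub>m partial_transpose d n (wishart N M g)" for g
  have A: "A g \<in> carrier_mat N N" for g
    by (simp add: A_def partial_transpose_def N_def)
  have S: "finite S"
    by (simp add: S_def)
  note cyc_succ = cyc_succ_permutes[OF S]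
  \<comment> \<open>Row indices of the Gaussian entry (\<open>x\<close>) and of the conjugated entry
    (\<open>y\<close>) in the \<open>s\<close>-th factor.\<close>
  define x where "x f s = (f s div n) * n + f (cyc_succ S s) mod n" for f :: "nat \<Rightarrow> nat" and s
  define y where "y f s = (f (cyc_succ S s) div n) * n + f s mod n" for f :: "nat \<Rightarrow> nat" and s
  define F where "F = (S \<rightarrow>\<^sub>E {..<N} :: (nat \<Rightarrow> nat) set)"
  define C where "C = (S \<rightarrow>\<^sub>E {0..<M} :: (nat \<Rightarrow> nat) set)"
  have fin: "finite F" "finite C" "finite {f. f permutes S}"
    using S by (auto simp: F_def C_def intro!: finite_PiE finite_permutations)
  have fS: "f s < N" "f (cyc_succ S s) < N" if "f \<in> F" "s \<in> S" for f s
    using that cyc_succ by (auto simp: F_def PiE_iff permutes_in_image)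
  have tr: "ntrace (A g ^\<^sub>m p) =
      (\<Sum>f\<in>F. \<Sum>c\<in>C. \<Prod>s\<in>S. g (x f s, c s) * cnj (g (y f s, c s))) / of_nat (N * d ^ p)" for g
  proof -
    have "ntrace (A g ^\<^sub>m p) = (\<Sum>i<N. (A g ^\<^sub>m p) $$ (i, i)) / of_nat N"
      using carrier_matD(1)[OF pow_carrier_mat[OF A], of g p] by (simp only: ntrace_def)
    also have "(\<Sum>i<N. (A g ^\<^sub>m p) $$ (i, i)) = (\<Sum>f\<in>F. \<Prod>s\<in>S. A g $$ (f s, f (cyc_succ S s)))"
      unfolding F_def S_def by (rule trace_pow_mat[OF A p])
    also have "\<dots> = (\<Sum>f\<in>F. \<Prod>s\<in>S. (\<Sum>c\<in>{0..<M}. g (x f s, c) * cnj (g (y f s, c))) / of_nat d)"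
    proof (intro sum.cong prod.cong refl)
      fix f s assume "f \<in> F" "s \<in> S"
      then show "A g $$ (f s, f (cyc_succ S s)) = (\<Sum>c\<in>{0..<M}. g (x f s, c)
          * cnj (g (y f s, c))) / of_nat d"
        using wishart_partial_transpose_index(1)[of "f s" d n "f (cyc_succ S s)" m g] fS m
        by (simp add: A_def N_def M_def x_def y_def)
    qed
    also have "\<dots> = (\<Sum>f\<in>F. (\<Sum>c\<in>C. \<Prod>s\<in>S. g (x f s, c s) * cnj (g (y f s, c s))) / of_nat d ^ p)"
    proof (intro sum.cong refl)
      fix f
      have "(\<Prod>s\<in>S. (\<Sum>c\<in>{0..<M}. g (x f s, c) * cnj (g (y f s, c))) / of_nat d) =
          (\<Prod>s\<in>S. \<Sum>c\<in>{0..<M}. g (x f s, c) * cnj (g (y f s, c))) / of_nat d ^ p"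
        by (simp add: prod_dividef S_def)
      also have "(\<Prod>s\<in>S. \<Sum>c\<in>{0..<M}. g (x f s, c) * cnj (g (y f s, c))) =
          (\<Sum>c\<in>C. \<Prod>s\<in>S. g (x f s, c s) * cnj (g (y f s, c s)))"
        unfolding C_def by (rule prod_sum_PiE[OF S]) simp
      finally show "(\<Prod>s\<in>S. (\<Sum>c\<in>{0..<M}. g (x f s, c) * cnj (g (y f s, c))) / of_nat d) =
          (\<Sum>c\<in>C. \<Prod>s\<in>S. g (x f s, c s) * cnj (g (y f s, c s))) / of_nat d ^ p" .
    qed
    finally show ?thesis
      by (simp add: sum_divide_distrib mult.commute)
  qed
  have range: "(\<lambda>s. (x f s, c s)) ` S \<subseteq> {0..<N} \<times> {0..<M}" "(\<lambda>s. (y f s, c s)) ` S \<subseteq> {0..<N} \<times>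
      {0..<M}"
    if "f \<in> F" "c \<in> C" for f c
    using fS[OF that(1)] that(2) m wishart_partial_transpose_index(2)[of _ d n _ m]
    by (auto simp: C_def PiE_iff x_def y_def N_def)
  have "(\<integral>g. ntrace (A g ^\<^sub>m p) \<partial>gaussian_matrix_space N M) =
      (\<Sum>f\<in>F. \<Sum>c\<in>C. \<integral>g. (\<Prod>s\<in>S. g (x f s, c s) * cnj (g (y f s, c s))) \<partial>gaussian_matrix_space N M) /
          of_nat (N * d ^ p)"
    unfolding tr using integrable_gaussian_product[OF S range]
        by (simp add: Bochner_Integration.integral_sum)
  also have "(\<Sum>f\<in>F. \<Sum>c\<in>C. \<integral>g. (\<Prod>s\<in>S. g (x f s, c s) * cnj (g (y f s, c s))) \<partial>gaussian_matrix_space N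
      M) =
      (\<Sum>f\<in>F. \<Sum>c\<in>C. of_nat (card {t\<in>{t. t permutes S}. (\<forall>s\<in>S. x f (t s) = y f s) \<and> (\<forall>s\<in>S. c (t s)
          = c s)}))"
  proof (intro sum.cong refl)
    fix f c assume "f \<in> F" "c \<in> C"
    moreover have "{t. t permutes S \<and> (\<forall>s\<in>S. (x f (t s), c (t s)) = (y f s, c s))} =
        {t\<in>{t. t permutes S}. (\<forall>s\<in>S. x f (t s) = y f s) \<and> (\<forall>s\<in>S. c (t s) = c s)}"
      by auto
    ultimately show "(\<integral>g. (\<Prod>s\<in>S. g (x f s, c s) * cnj (g (y f s, c s))) \<partial>gaussian_matrix_space N M) =
        of_nat (card {t\<in>{t. t permutes S}. (\<forall>s\<in>S. x f (t s) = y f s) \<and> (\<forall>s\<in>S. c (t s) = c s)})"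
      using wick_formula[OF S range] by simp
  qed
  also have "\<dots> = of_nat (\<Sum>f\<in>F. \<Sum>c\<in>C. card {t\<in>{t. t permutes S}. (\<forall>s\<in>S. x f (t s) = y f s)
      \<and> (\<forall>s\<in>S. c (t s) = c s)})"
    by simp
  also have "(\<Sum>f\<in>F. \<Sum>c\<in>C. card {t\<in>{t. t permutes S}. (\<forall>s\<in>S. x f (t s) = y f s) \<and> (\<forall>s\<in>S. c (t s)
      = c s)}) =
      (\<Sum>t | t permutes S. card {f\<in>F. \<forall>s\<in>S. x f (t s) = y f s} * card {c\<in>C. \<forall>s\<in>S. c (t s) = c s})"
    by (rule sum_card_Collect_conj[OF fin])
  also have "\<dots> = (\<Sum>t | t permutes S. (d * m) ^ num_orbits t S
      * (d ^ num_orbits (cyc_succ S \<circ> inv_into UNIV t) S * n ^ num_orbits (cyc_succ S \<circ> t) S))"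
  proof (intro sum.cong refl)
    fix t assume "t \<in> {t. t permutes S}"
    then have t: "t permutes S"
      by simp
    show "card {f\<in>F. \<forall>s\<in>S. x f (t s) = y f s} * card {c\<in>C. \<forall>s\<in>S. c (t s) = c s} =
        (d * m) ^ num_orbits t S * (d ^ num_orbits (cyc_succ S \<circ> inv_into UNIV t) S
            * n ^ num_orbits (cyc_succ S \<circ> t) S)"
      using card_invariant_functions[OF t S, of "{0..<M}"] card_partial_transpose_indices[OF t
          cyc_succ S n, of d]
      by (simp add: F_def C_def N_def M_def x_def y_def)
  qed
  finally show ?thesis
    by (simp add: A_def N_def M_def)
qed

theorem theorem1p2:
  fixes n m p :: nat
  assumes "n \<ge> 1" and "m \<ge> 1" and "p \<ge> 1"
  shows "(\<lambda>d. \<integral>g. ntrace ((of_nat m \<cdot>\<^sub>m partial_transpose d n (wishart (d * n) (d * m) g)) ^\<^sub>m p)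
                 \<partial>gaussian_matrix_space (d * n) (d * m))
         \<longlonglongrightarrow> (\<Sum>\<pi>\<in>NC p. of_nat m ^ num_blocks \<pi> * of_nat n ^ num_even_blocks \<pi>)"
proof -
  define S where "S = {1..p}"
  have S: "finite S" "S \<noteq> {}" "card S = p"
    using assms(3) by (auto simp: S_def)
  have NC: "NC p = {P. partition_on S P \<and> noncrossing P}"
    by (simp add: NC_def S_def)
  define a where "a f = num_orbits f S" for f
  define b where "b f = num_orbits (cyc_succ S \<circ> inv_into UNIV f) S" for f
  define c where "c f = num_orbits (cyc_succ S \<circ> f) S" for f
  \<comment> \<open>The contribution of \<open>f\<close> stripped of all powers of \<open>d\<close>;
    the division by \<open>n\<close> comes from the normalised trace.\<close>
  define w :: "(nat \<Rightarrow> nat) \<Rightarrow> complex" where "w f = of_nat m ^ a f * of_nat n ^ c f / of_nat n" for f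
  define r :: "nat \<Rightarrow> complex" where "r d = 1 / of_nat d" for d
  have le: "a f + b f \<le> p + 1" if "f permutes S" for f
    using num_orbits_genus[OF S(1,2) that] S(3) by (simp add: a_def b_def)
  have "r \<longlonglongrightarrow> 0"
    unfolding r_def by (rule lim_1_over_n)
  \<comment> \<open>By \<open>le\<close> the subtraction in the exponent does not truncate, and
    \<open>0 ^ 0 = 1\<close> singles out the permutations that attain the bound.\<close>
  then have "(\<lambda>d. \<Sum>f | f permutes S. w f * r d ^ (p + 1 - (a f + b f)))
      \<longlonglongrightarrow> (\<Sum>f | f permutes S. w f * 0 ^ (p + 1 - (a f + b f)))"
    by (intro tendsto_intros)
  moreover have "\<forall>\<^sub>F d in sequentially. (\<Sum>f | f permutes S. w f * r d ^ (p + 1 - (a f + b f))) =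
      (\<integral>g. ntrace ((of_nat m \<cdot>\<^sub>m partial_transpose d n (wishart (d * n) (d * m) g)) ^\<^sub>m p)
        \<partial>gaussian_matrix_space (d * n) (d * m))"
    using eventually_ge_at_top[of 1]
  proof eventually_elim
    case (elim d)
    show ?case
      unfolding expectation_wishart_partial_transpose[OF assms elim] S_def[symmetric] sum_divide_distrib
    proof (intro sum.cong refl)
      fix f assume "f \<in> {f. f permutes S}"
      then have "a f + b f + (p + 1 - (a f + b f)) = p + 1"
        using le[of f] by simp
      then have "(of_nat d :: complex) ^ (p + 1) = of_nat d ^ a f * of_nat d ^ b f * of_nat d ^ (p + 1 - (a f + b f))"
        by (metis power_add)
      then show "w f * r d ^ (p + 1 - (a f + b f)) =
          of_nat ((d * m) ^ num_orbits f S * (d ^ num_orbits (cyc_succ S \<circ> inv_into UNIV f) S * n ^ num_orbits (cyc_succ S \<circ> f) S))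
            / of_nat (d * n * d ^ p)"
        using elim assms by (simp add: w_def r_def a_def b_def c_def field_simps power_mult_distrib)
    qed
  qed
  ultimately have lim: "(\<lambda>d. \<integral>g. ntrace ((of_nat m \<cdot>\<^sub>m partial_transpose d n (wishart (d * n) (d * m) g)) ^\<^sub>m p)
        \<partial>gaussian_matrix_space (d * n) (d * m))
      \<longlonglongrightarrow> (\<Sum>f | f permutes S. w f * 0 ^ (p + 1 - (a f + b f)))"
    by (rule Lim_transform_eventually)
  define G where "G = {f. f permutes S \<and> a f + b f = p + 1}"
  have "(\<Sum>f | f permutes S. w f * 0 ^ (p + 1 - (a f + b f))) = (\<Sum>f\<in>G. w f)"
    using le S(1) finite_permutations[OF S(1)]
    by (intro sum.mono_neutral_cong_right) (auto simp: G_def le_less)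
  also have "\<dots> = (\<Sum>\<pi>\<in>NC p. w (block_perm \<pi>))"
  proof (rule sum.reindex_bij_betw[symmetric])
    have "inj_on block_perm (NC p)"
      using block_perm_inject[OF _ _ S(1)] by (auto simp: NC intro: inj_onI)
    moreover have "block_perm ` NC p = G"
    proof
      show "block_perm ` NC p \<subseteq> G"
        using num_orbits_block_perm[OF S(1,2)] block_perm_permutes[OF _ S(1)] S(3)
        by (auto simp: NC G_def a_def b_def)
      show "G \<subseteq> block_perm ` NC p"
        using num_orbits_genus[OF S(1,2)] S(3)
        by (auto simp: NC G_def a_def b_def)
    qed
    ultimately show "bij_betw block_perm (NC p) G"
      by (simp add: bij_betw_def)
  qed
  also have "\<dots> = (\<Sum>\<pi>\<in>NC p. of_nat m ^ num_blocks \<pi> * of_nat n ^ num_even_blocks \<pi>)"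
  proof (intro sum.cong refl)
    fix P assume "P \<in> NC p"
    \<comment> \<open>Here \<open>c\<close> is the number of even blocks plus 1, and the extra
      factor \<open>n\<close> cancels the division by \<open>n\<close> in \<open>w\<close>.\<close>
    then show "w (block_perm P) = of_nat m ^ num_blocks P * of_nat n ^ num_even_blocks P"
      using num_orbits_block_perm[OF S(1,2), of P] assms(1)
      by (auto simp: NC w_def a_def c_def num_blocks_def)
  qed
  finally show ?thesis
    using lim by simp
qed

end
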